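(* Let $\mathsf{k}$ be a field, let $A$ be an affine (finitely generated) commutative $\mathsf{k}$-algebra which is a domain and is not integrally closed, let $\bar{A}$ be its integral closure in its field of fractions, and let $K=\mathrm{Frac}\,A=\mathrm{Frac}\,\bar{A}$. Then $\bar{A}$ is a Galois $A$-order (with $\Lambda=\Gamma=A$ and $\mathcal{M}$, $W$ trivial, so that $\mathcal{K}=\mathcal{L}=K$) which is not a principal Galois order.
   Context: Specialized to trivial $\mathcal{M}$ and $W$ and $\Lambda=\Gamma=A$, with $L=K=\mathcal{L}=\mathcal{K}=\mathrm{Frac}\,A$, the notions are as follows. A Galois $A$-ring in $K$ is a $\mathsf{k}$-subalgebra $U\subset K$ with $A\subset U$ and $KU=K$ (with $A$ Noetherian). A Galois $A$-ring $U$ is a Galois order if for every finite-dimensional $K$-vector subspace $V$ of $\mathcal{K}=K$, $U\cap V$ is a finitely generated $A$-module. It is a principal Galois order if for every $X\in U$ one has $X(A)\subset A$, where $X(l)=Xl$ for $l\in K$. *)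

theory Defs
  imports "HOL-Computational_Algebra.Computational_Algebra" "HOL.Hull"
begin

text \<open>
  The domain \<open>A\<close> is an arbitrary type of class \<open>idom\<close>, the field \<open>K = Frac A\<close> is its type of
  fractions \<open>'a fract\<close>, and \<open>A\<close> is identified with the subring \<open>range to_fract\<close> of \<open>K\<close>.
  A \<open>k\<close>-algebra structure on a ring is given by its scalar multiplication.
\<close>

section \<open>Commutative algebra\<close>

locale comm_k_algebra = vector_space scale
  for scale :: "'k::field \<Rightarrow> 'b::comm_ring_1 \<Rightarrow> 'b" +
  assumes scale_mult_left: "scale c x * y = scale c (x * y)"

definition is_subalgebra :: "('k::field \<Rightarrow> 'b::comm_ring_1 \<Rightarrow> 'b) \<Rightarrow> 'b set \<Rightarrow> bool" where
  "is_subalgebra scale S \<longleftrightarrow>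
     module.subspace scale S \<and> 1 \<in> S \<and> (\<forall>x\<in>S. \<forall>y\<in>S. x * y \<in> S)"

definition finitely_generated_algebra :: "('k::field \<Rightarrow> 'b::comm_ring_1 \<Rightarrow> 'b) \<Rightarrow> bool" where
  "finitely_generated_algebra scale \<longleftrightarrow> (\<exists>S. finite S \<and> is_subalgebra scale hull S = UNIV)"

locale affine_algebra = comm_k_algebra scale
  for scale :: "'k::field \<Rightarrow> 'b::comm_ring_1 \<Rightarrow> 'b" +
  assumes finitely_generated: "finitely_generated_algebra scale"

definition fg_submodule :: "('r::comm_ring_1 \<Rightarrow> 'm::ab_group_add \<Rightarrow> 'm) \<Rightarrow> 'm set \<Rightarrow> bool" where
  "fg_submodule scale N \<longleftrightarrow> (\<exists>S. finite S \<and> module.span scale S = N)"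

text \<open>The ideals of a commutative ring are its submodules as a module over itself.\<close>

definition noetherian :: "'r::comm_ring_1 itself \<Rightarrow> bool" where
  "noetherian _ \<longleftrightarrow>
     (\<forall>I :: 'r set. module.subspace (*) I \<longrightarrow> fg_submodule ((*) :: 'r \<Rightarrow> 'r \<Rightarrow> 'r) I)"

section \<open>The field of fractions and the integral closure\<close>

definition fract_smult :: "'a::idom \<Rightarrow> 'a fract \<Rightarrow> 'a fract" where
  "fract_smult a x = to_fract a * x"

text \<open>The \<open>k\<close>-algebra structure that \<open>Frac A\<close> inherits from that of \<open>A\<close>.\<close>

definition fract_scale :: "('k::field \<Rightarrow> 'a::idom \<Rightarrow> 'a) \<Rightarrow> 'k \<Rightarrow> 'a fract \<Rightarrow> 'a fract" where
  "fract_scale scale c x = to_fract (scale c 1) * x"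

definition integral_closure :: "'a::idom fract set" where
  "integral_closure = {x. \<exists>p :: 'a poly. lead_coeff p = 1 \<and> poly (map_poly to_fract p) x = 0}"

definition integrally_closed :: "'a::idom itself \<Rightarrow> bool" where
  "integrally_closed _ \<longleftrightarrow> (integral_closure :: 'a fract set) = range to_fract"

lemma module_fract_smult: "module (fract_smult :: 'a::idom \<Rightarrow> 'a fract \<Rightarrow> 'a fract)"
  by unfold_locales (simp_all add: fract_smult_def algebra_simps)

lemma comm_k_algebra_fract_scale:
  assumes "comm_k_algebra scale"
  shows "comm_k_algebra (fract_scale scale)"
proof -
  interpret comm_k_algebra scale by fact
  have "scale c 1 * scale d 1 = scale (c * d) 1" for c d
    by (simp add: scale_mult_left)
  then show ?thesis
    by unfold_locales
      (simp_all add: fract_scale_def algebra_simps scale_left_distrib flip: to_fract_mult)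
qed

lemma to_fract_in_integral_closure: "to_fract a \<in> integral_closure"
  unfolding integral_closure_def
  by (intro CollectI exI[of _ "[:- a, 1:]"]) (simp add: map_poly_pCons)

text \<open>\<open>Frac A\<close> is also the field of fractions of the integral closure.\<close>

lemma fract_eq_quotient_integral_closure:
  "\<exists>a \<in> integral_closure. \<exists>b \<in> integral_closure. b \<noteq> 0 \<and> x = a / b"
proof (cases x)
  case (Fract a b)
  then have "to_fract b \<noteq> 0" "x = to_fract a / to_fract b"
    by (simp_all add: to_fract_def Zero_fract_def eq_fract)
  then show ?thesis
    using to_fract_in_integral_closure by blast
qed

section \<open>Galois rings and Galois orders\<close>

text \<open>
  These are the notions for \<open>\<Lambda> = \<Gamma> = A\<close> and trivial \<open>\<M>\<close> and \<open>W\<close>, so that both skew monoid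
  rings are \<open>K = Frac A\<close>. Spans over the scalar multiplication \<open>(*)\<close> of \<open>K\<close> are \<open>K\<close>-linear
  ones; in particular the span of \<open>U\<close> is \<open>KU\<close>.
\<close>

definition galois_ring :: "('k::field \<Rightarrow> 'a::idom \<Rightarrow> 'a) \<Rightarrow> 'a fract set \<Rightarrow> bool" where
  "galois_ring scale U \<longleftrightarrow>
     noetherian TYPE('a) \<and>
     is_subalgebra (fract_scale scale) U \<and>
     range to_fract \<subseteq> U \<and>
     module.span (*) U = UNIV"

definition galois_order :: "('k::field \<Rightarrow> 'a::idom \<Rightarrow> 'a) \<Rightarrow> 'a fract set \<Rightarrow> bool" where
  "galois_order scale U \<longleftrightarrow>
     galois_ring scale U \<and>
     (\<forall>V. module.subspace (*) V \<and> fg_submodule (*) V \<longrightarrow> fg_submodule fract_smult (U \<inter> V))"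

definition fract_act :: "'a::idom fract \<Rightarrow> 'a fract \<Rightarrow> 'a fract" where
  "fract_act X l = X * l"

definition principal_galois_order :: "('k::field \<Rightarrow> 'a::idom \<Rightarrow> 'a) \<Rightarrow> 'a fract set \<Rightarrow> bool" where
  "principal_galois_order scale U \<longleftrightarrow>
     galois_ring scale U \<and>
     (\<forall>X\<in>U. fract_act X ` range to_fract \<subseteq> range to_fract)"

end

theory Submission
  imports Defs
begin

text \<open>
  The only \<open>K\<close>-subspaces of \<open>K\<close> are \<open>0\<close> and \<open>K\<close>, so being a Galois order amounts to the finiteness of
  the integral closure over \<open>A\<close>, and an element of the closure outside \<open>A\<close> moves \<open>1\<close> out of \<open>A\<close>.

  In positive characteristic the trace form may vanish, so finiteness is obtained differently. By
  Noether normalization \<open>A\<close> is finite over a polynomial ring \<open>P = k[X]\<close>. Fix \<open>x\<close> in \<open>X\<close>, let \<open>E\<close> be the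
  field generated by the other variables, and let \<open>B\<close> be a basis of \<open>K\<close> over \<open>E(x)\<close>. All powers of an
  integral element \<open>z\<close> have a common denominator with respect to the lattice \<open>E[x]B\<close>. If the coordinates
  of \<open>z\<close> vanish to high enough order at \<open>x = \<infinity>\<close>, then those of the powers of \<open>z\<close> vanish to arbitrarily
  high order, whence \<open>z = 0\<close>. So modulo the lattice the integral elements form an \<open>E\<close>-vector space of
  finite dimension, and a single \<open>c\<close> multiplies all of them into \<open>E[x]B\<close>. Taking the product of these
  \<open>c\<close> over all variables and intersecting the rings \<open>E[x]\<close> gives a common denominator over \<open>P\<close>, and \<open>P\<close>
  is Noetherian.
\<close>

section \<open>Subrings, submodules and Noetherian subrings\<close>

text \<open>The obstacle is that the integral closure is in general no vector space over
  \<open>E\<close>, so dimensions cannot be counted in it. For each variable it is therefore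
  enlarged by inverting the nonzero polynomials in the other variables. The finitely many vectors
  that remain modulo the lattice have coordinates in \<open>Frac P\<close>, so their common
  denominator \<open>c\<close> can be taken in \<open>P\<close> rather than in \<open>E[x]\<close>;
  this is what allows the denominators of different variables to be multiplied. Geometrically, a
  lattice over \<open>E[x]\<close> and one over the valuation ring at infinity glue to a vector
  bundle on the projective line over \<open>E\<close>. With the same basis for both, the bundle is
  trivial, and the count rests on two facts: a section vanishing at infinity is zero, and every
  vector of \<open>K\<close> is a sum of one vector from each lattice. Integrality enters only
  through common denominators of powers, so inseparable extensions are covered as well.\<close>

definition subring :: "'a::comm_ring_1 set \<Rightarrow> bool" where
  "subring R \<longleftrightarrow> 1 \<in> R \<and> (\<forall>x\<in>R. \<forall>y\<in>R. x - y \<in> R \<and> x * y \<in> R)"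

definition subfield :: "'a::field set \<Rightarrow> bool" where
  "subfield R \<longleftrightarrow> subring R \<and> (\<forall>x\<in>R. inverse x \<in> R)"

text \<open>Scalars and vectors share one ambient ring, so a change of scalars among
  \<open>E\<close>, \<open>P\<close> and \<open>A\<close> is just a change of the first
  argument.\<close>

definition submodule :: "'a::comm_ring_1 set \<Rightarrow> 'a set \<Rightarrow> bool" where
  "submodule R N \<longleftrightarrow> 0 \<in> N \<and> (\<forall>x\<in>N. \<forall>y\<in>N. x + y \<in> N) \<and> (\<forall>r\<in>R. \<forall>x\<in>N. r * x \<in> N)"

text \<open>The set \<open>T\<close> indexes its own combinations. Over an infinite \<open>T\<close>
  the sum is \<open>0\<close> by convention, hence generating sets are taken finite.\<close>

definition span_over :: "'a::comm_ring_1 set \<Rightarrow> 'a set \<Rightarrow> 'a set" where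
  "span_over R T = {\<Sum>t\<in>T. c t * t | c. \<forall>t\<in>T. c t \<in> R}"

definition noetherian_subring :: "'a::comm_ring_1 set \<Rightarrow> bool" where
  "noetherian_subring R \<longleftrightarrow>
     subring R \<and> (\<forall>I\<subseteq>R. submodule R I \<longrightarrow> (\<exists>T. finite T \<and> I = span_over R T))"

section \<open>Closure properties of subrings, subfields and submodules\<close>

lemma subring_1: "subring R \<Longrightarrow> 1 \<in> R"
  and subring_diff: "subring R \<Longrightarrow> x \<in> R \<Longrightarrow> y \<in> R \<Longrightarrow> x - y \<in> R"
  and subring_mult: "subring R \<Longrightarrow> x \<in> R \<Longrightarrow> y \<in> R \<Longrightarrow> x * y \<in> R"
  by (auto simp: subring_def)

lemma subring_0: "subring R \<Longrightarrow> 0 \<in> R"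
  using subring_diff[of R 1 1] subring_1 by auto

lemma subring_uminus: "subring R \<Longrightarrow> x \<in> R \<Longrightarrow> - x \<in> R"
  using subring_diff[of R 0 x] subring_0 by auto

lemma subring_add: "subring R \<Longrightarrow> x \<in> R \<Longrightarrow> y \<in> R \<Longrightarrow> x + y \<in> R"
  using subring_diff[of R x "- y"] subring_uminus by auto

lemma subring_power: "subring R \<Longrightarrow> x \<in> R \<Longrightarrow> x ^ n \<in> R"
  by (induction n) (auto intro: subring_1 subring_mult)

lemma subring_sum: "subring R \<Longrightarrow> (\<And>i. i \<in> I \<Longrightarrow> f i \<in> R) \<Longrightarrow> sum f I \<in> R"
  by (induction I rule: infinite_finite_induct) (auto intro: subring_0 subring_add)

lemma subring_prod: "subring R \<Longrightarrow> (\<And>i. i \<in> I \<Longrightarrow> f i \<in> R) \<Longrightarrow> prod f I \<in> R"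
  by (induction I rule: infinite_finite_induct) (auto intro: subring_1 subring_mult)

lemmas subring_closed =
  subring_0 subring_1 subring_add subring_diff subring_mult subring_uminus subring_power

lemma subfield_subring: "subfield E \<Longrightarrow> subring E"
  and subfield_inverse: "subfield E \<Longrightarrow> x \<in> E \<Longrightarrow> inverse x \<in> E"
  by (auto simp: subfield_def)

lemma subfield_divide: "subfield E \<Longrightarrow> x \<in> E \<Longrightarrow> y \<in> E \<Longrightarrow> x / y \<in> E"
  by (simp add: divide_inverse subfield_inverse subring_mult subfield_subring)

lemma submodule_0: "submodule R N \<Longrightarrow> 0 \<in> N"
  and submodule_add: "submodule R N \<Longrightarrow> x \<in> N \<Longrightarrow> y \<in> N \<Longrightarrow> x + y \<in> N"
  and submodule_mult: "submodule R N \<Longrightarrow> r \<in> R \<Longrightarrow> x \<in> N \<Longrightarrow> r * x \<in> N"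
  by (auto simp: submodule_def)

lemma submodule_diff: "subring R \<Longrightarrow> submodule R N \<Longrightarrow> x \<in> N \<Longrightarrow> y \<in> N \<Longrightarrow> x - y \<in> N"
  using submodule_add[of R N x "- y"] submodule_mult[of R N "- 1" y]
  by (auto intro: subring_uminus subring_1)

lemma submodule_sum: "submodule R N \<Longrightarrow> (\<And>i. i \<in> I \<Longrightarrow> f i \<in> N) \<Longrightarrow> sum f I \<in> N"
  by (induction I rule: infinite_finite_induct) (auto intro: submodule_0 submodule_add)

lemma submodule_mono: "submodule R N \<Longrightarrow> Q \<subseteq> R \<Longrightarrow> submodule Q N"
  by (auto simp: submodule_def)

lemma submodule_Int: "submodule R M \<Longrightarrow> submodule R N \<Longrightarrow> submodule R (M \<inter> N)"
  by (auto simp: submodule_def)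

lemma submodule_subring: "subring S \<Longrightarrow> R \<subseteq> S \<Longrightarrow> submodule R S"
  by (auto simp: submodule_def intro: subring_closed)

text \<open>This is the colon module of \<open>N\<close> by \<open>v\<close>. Together with
  \<open>span_over_least\<close> it carries a membership from generators to a whole span.\<close>

lemma submodule_quotient: "submodule R N \<Longrightarrow> submodule R {u. u * v \<in> N}"
  by (auto simp: submodule_def algebra_simps)

section \<open>Linear spans with coefficients in a subring\<close>

lemma span_overI: "(\<And>t. t \<in> T \<Longrightarrow> c t \<in> R) \<Longrightarrow> (\<Sum>t\<in>T. c t * t) \<in> span_over R T"
  by (auto simp: span_over_def)

lemma span_overE:
  assumes "x \<in> span_over R T"
  obtains c where "\<And>t. t \<in> T \<Longrightarrow> c t \<in> R" "x = (\<Sum>t\<in>T. c t * t)"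
  using assms by (auto simp: span_over_def)

lemma submodule_span_over:
  assumes "subring R"
  shows "submodule R (span_over R T)"
  unfolding submodule_def
proof (intro conjI ballI)
  show "0 \<in> span_over R T"
    using span_overI[of T "\<lambda>_. 0" R] assms by (auto intro: subring_0)
next
  fix x y assume "x \<in> span_over R T" "y \<in> span_over R T"
  then obtain c d where cd: "\<And>t. t \<in> T \<Longrightarrow> c t \<in> R" "x = (\<Sum>t\<in>T. c t * t)"
     "\<And>t. t \<in> T \<Longrightarrow> d t \<in> R" "y = (\<Sum>t\<in>T. d t * t)"
    by (elim span_overE) blast
  then show "x + y \<in> span_over R T"
    using span_overI[of T "\<lambda>t. c t + d t" R] assms
    by (auto intro: subring_add simp: sum.distrib distrib_right)
next
  fix r x assume "r \<in> R" "x \<in> span_over R T"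
  then obtain c where c: "\<And>t. t \<in> T \<Longrightarrow> c t \<in> R" "x = (\<Sum>t\<in>T. c t * t)"
    by (elim span_overE) blast
  then show "r * x \<in> span_over R T"
    using span_overI[of T "\<lambda>t. r * c t" R] assms \<open>r \<in> R\<close>
    by (auto intro: subring_mult simp: sum_distrib_left mult.assoc)
qed

lemma span_over_base:
  assumes "subring R" "finite T" "t \<in> T"
  shows "t \<in> span_over R T"
proof -
  have "(\<Sum>s\<in>T. (if s = t then 1 else 0) * s) = t"
    using assms(2,3) by (subst sum.remove[of _ t]) (auto intro!: sum.neutral)
  moreover have "(\<Sum>s\<in>T. (if s = t then 1 else 0) * s) \<in> span_over R T"
    using assms(1) by (intro span_overI) (auto intro: subring_0 subring_1)
  ultimately show ?thesis by simp
qed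

lemma span_over_least: "submodule R N \<Longrightarrow> T \<subseteq> N \<Longrightarrow> span_over R T \<subseteq> N"
  by (auto elim!: span_overE intro!: submodule_sum submodule_mult)

lemma span_over_mono_ring: "Q \<subseteq> R \<Longrightarrow> span_over Q T \<subseteq> span_over R T"
  by (auto simp: span_over_def)

lemma span_over_mono:
  "subring R \<Longrightarrow> finite T \<Longrightarrow> S \<subseteq> T \<Longrightarrow> span_over R S \<subseteq> span_over R T"
  by (meson span_over_least submodule_span_over span_over_base subset_eq)

text \<open>By bilinearity: the colon module argument is applied in one factor and then in the
  other.\<close>

lemma span_over_mult_mem:
  assumes "submodule R W" "\<And>s t. s \<in> S \<Longrightarrow> t \<in> T \<Longrightarrow> s * t \<in> W"
    "u \<in> span_over R S" "v \<in> span_over R T"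
  shows "u * v \<in> W"
proof -
  have "s * v \<in> W" if "s \<in> S" for s
  proof -
    have "T \<subseteq> {u. u * s \<in> W}"
      using assms(2) that by (auto simp: mult.commute[of _ s])
    then show ?thesis
      using span_over_least[OF submodule_quotient[OF assms(1)]] assms(4)
      by (auto simp: mult.commute[of s])
  qed
  then show ?thesis
    using span_over_least[OF submodule_quotient[OF assms(1), of v], of S] assms(3) by auto
qed

text \<open>The sum \<open>L + M\<close> need not be direct: \<open>J\<close> in the proof stands in for the image of \<open>N\<close> in the
  quotient by \<open>M\<close>.\<close>

lemma finitely_generated_extension:
  assumes R: "subring R" and N: "submodule R N" and M: "submodule R M" and L: "submodule R L"
    and N_sub: "\<And>n. n \<in> N \<Longrightarrow> \<exists>l\<in>L. \<exists>m\<in>M. n = l + m"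
    and fgL: "\<And>J. submodule R J \<Longrightarrow> J \<subseteq> L \<Longrightarrow> \<exists>T. finite T \<and> J = span_over R T"
    and fgM: "\<exists>T. finite T \<and> N \<inter> M = span_over R T"
  shows "\<exists>T. finite T \<and> N = span_over R T"
proof -
  define J where "J = {l\<in>L. \<exists>m\<in>M. l + m \<in> N}"
  have "submodule R J"
    unfolding submodule_def
  proof (intro conjI ballI)
    show "0 \<in> J" unfolding J_def using submodule_0[OF N] submodule_0[OF M] submodule_0[OF L]
      by (auto intro!: bexI[of _ 0])
  next
    fix x y assume "x \<in> J" "y \<in> J"
    then obtain m n where "x \<in> L" "y \<in> L" "m \<in> M" "n \<in> M" "x + m \<in> N" "y + n \<in> N"
      by (auto simp: J_def)
    then show "x + y \<in> J"
      using submodule_add[OF N, of "x + m" "y + n"] submodule_add[OF M] submodule_add[OF L]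
      by (auto simp: J_def algebra_simps intro!: bexI[of _ "m + n"])
  next
    fix r x assume "r \<in> R" "x \<in> J"
    then obtain m where "x \<in> L" "m \<in> M" "x + m \<in> N"
      by (auto simp: J_def)
    then show "r * x \<in> J"
      using submodule_mult[OF N \<open>r \<in> R\<close>, of "x + m"] submodule_mult[OF M \<open>r \<in> R\<close>]
        submodule_mult[OF L \<open>r \<in> R\<close>]
      by (auto simp: J_def distrib_left intro!: bexI[of _ "r * m"])
  qed
  then obtain T where T: "finite T" "J = span_over R T"
    using fgL[of J] by (auto simp: J_def)
  \<comment> \<open>Each generator of \<open>J\<close> gets a correction in \<open>M\<close> that
    puts it into \<open>N\<close>.\<close>
  have "\<forall>t\<in>T. \<exists>m\<in>M. t + m \<in> N"
    using span_over_base[OF R T(1)] T(2) by (auto simp: J_def)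
  then obtain h where h: "\<And>t. t \<in> T \<Longrightarrow> h t \<in> M" "\<And>t. t \<in> T \<Longrightarrow> t + h t \<in> N"
    by metis
  from fgM obtain S where S: "finite S" "N \<inter> M = span_over R S" by blast
  let ?G = "(\<lambda>t. t + h t) ` T \<union> S"
  have "finite ?G" using T S by auto
  have G: "?G \<subseteq> N"
    using h(2) span_over_base[OF R S(1)] S(2) by auto
  have "n \<in> span_over R ?G" if "n \<in> N" for n
  proof -
    from N_sub[OF that] obtain l m where lm: "l \<in> L" "m \<in> M" "n = l + m" by blast
    then have "l \<in> J" using that by (auto simp: J_def)
    then obtain c where c: "\<And>t. t \<in> T \<Longrightarrow> c t \<in> R" "l = (\<Sum>t\<in>T. c t * t)"
      unfolding T(2) by (elim span_overE) blast
    \<comment> \<open>The same coefficients on the corrected generators reproduce \<open>l\<close>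
      up to an element of \<open>M\<close>, so the difference from \<open>n\<close> falls into
      \<open>N \<inter> M\<close>.\<close>
    have lift: "(\<Sum>t\<in>T. c t * (t + h t)) = l + (\<Sum>t\<in>T. c t * h t)"
      by (simp add: c(2) algebra_simps sum.distrib)
    have 1: "(\<Sum>t\<in>T. c t * (t + h t)) \<in> span_over R ?G"
      using \<open>finite ?G\<close> c(1)
      by (intro submodule_sum[OF submodule_span_over[OF R]]
          submodule_mult[OF submodule_span_over[OF R]] span_over_base[OF R]) auto
    then have "(\<Sum>t\<in>T. c t * (t + h t)) \<in> N"
      using span_over_least[OF N G] by auto
    then have "n - (\<Sum>t\<in>T. c t * (t + h t)) \<in> N"
      using submodule_diff[OF R N that] by auto
    moreover have "n - (\<Sum>t\<in>T. c t * (t + h t)) = m - (\<Sum>t\<in>T. c t * h t)"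
      by (simp add: lift lm)
    moreover have "m - (\<Sum>t\<in>T. c t * h t) \<in> M"
      using c(1) h(1) lm
      by (intro submodule_diff[OF R M] submodule_sum[OF M] submodule_mult[OF M]) auto
    ultimately have "n - (\<Sum>t\<in>T. c t * (t + h t)) \<in> span_over R S"
      using S(2) by auto
    then have "n - (\<Sum>t\<in>T. c t * (t + h t)) \<in> span_over R ?G"
      using span_over_mono[OF R \<open>finite ?G\<close>, of S] by auto
    from submodule_add[OF submodule_span_over[OF R] this 1] show ?thesis by simp
  qed
  then have "N = span_over R ?G"
    using span_over_least[OF N G] by auto
  then show ?thesis using \<open>finite ?G\<close> by blast
qed

section \<open>Finite generation over Noetherian subrings\<close>

lemma noetherian_subring_subring: "noetherian_subring R \<Longrightarrow> subring R"
  by (simp add: noetherian_subring_def)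

text \<open>Induction on the generators: the cyclic module on the new generator \<open>t\<close>
  plays the part of \<open>L\<close> in \<open>finitely_generated_extension\<close>, and the span of
  the others that of \<open>M\<close>.\<close>

lemma noetherian_submodule_fg:
  assumes R: "noetherian_subring R" and "finite T"
    and "submodule R N" "N \<subseteq> span_over R T"
  shows "\<exists>S. finite S \<and> N = span_over R S"
  using assms(2-)
proof (induction T arbitrary: N rule: finite_induct)
  case empty
  then have "N = span_over R {}"
    using submodule_0[of R N] by (auto simp: span_over_def)
  then show ?case by blast
next
  case (insert t T)
  note sub = noetherian_subring_subring[OF R]
  define L where "L = (\<lambda>r. r * t) ` R"
  show ?case
  proof (rule finitely_generated_extension[where L = L and M = "span_over R T"])
    show "submodule R L"
      unfolding submodule_def L_def
    proof (intro conjI ballI)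
      show "0 \<in> (\<lambda>r. r * t) ` R"
        using subring_0[OF sub] by (metis image_eqI mult_zero_left)
    next
      fix x y assume "x \<in> (\<lambda>r. r * t) ` R" "y \<in> (\<lambda>r. r * t) ` R"
      then show "x + y \<in> (\<lambda>r. r * t) ` R"
        using subring_add[OF sub] by (auto simp flip: distrib_right)
    next
      fix r x assume "r \<in> R" "x \<in> (\<lambda>r. r * t) ` R"
      then show "r * x \<in> (\<lambda>r. r * t) ` R"
        using subring_mult[OF sub] by (auto simp flip: mult.assoc)
    qed
  next
    fix n assume "n \<in> N"
    then have "n \<in> span_over R (insert t T)" using insert by auto
    then obtain c where "\<And>s. s \<in> insert t T \<Longrightarrow> c s \<in> R" "n = (\<Sum>s\<in>insert t T. c s * s)"
      by (elim span_overE) blast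
    then have "c t * t \<in> L" "(\<Sum>s\<in>T. c s * s) \<in> span_over R T"
        "n = c t * t + (\<Sum>s\<in>T. c s * s)"
      using insert(1,2) span_overI[of T c R] by (auto simp: L_def)
    then show "\<exists>l\<in>L. \<exists>m\<in>span_over R T. n = l + m" by blast
  next
    fix J assume J: "submodule R J" "J \<subseteq> L"
    \<comment> \<open>A submodule of \<open>R t\<close> is \<open>I t\<close> for the ideal
      \<open>I\<close> of its coefficients, so the Noetherian property of \<open>R\<close> applies
      to \<open>I\<close>.\<close>
    define I where "I = R \<inter> {r. r * t \<in> J}"
    have "submodule R I"
      unfolding I_def
      by (intro submodule_Int submodule_subring[OF sub] submodule_quotient[OF J(1)] subset_refl)
    then obtain S where S: "finite S" "I = span_over R S"
      using R unfolding noetherian_subring_def I_def by blast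
    have "J = span_over R ((\<lambda>s. s * t) ` S)" (is "_ = ?rhs")
    proof
      show "?rhs \<subseteq> J"
        using span_over_base[OF sub S(1)] S(2)
        by (intro span_over_least[OF J(1)]) (auto simp: I_def)
      have "I \<subseteq> {r. r * t \<in> ?rhs}"
        unfolding S(2) using S(1)
        by (intro span_over_least submodule_quotient submodule_span_over sub)
           (auto intro!: span_over_base sub)
      then show "J \<subseteq> ?rhs"
        using J(2) by (auto simp: L_def I_def)
    qed
    then show "\<exists>S. finite S \<and> J = span_over R S"
      using S(1) by blast
  next
    show "\<exists>S. finite S \<and> N \<inter> span_over R T = span_over R S"
      by (intro insert.IH submodule_Int submodule_span_over sub insert.prems) auto
  qed (use insert.prems sub in \<open>auto intro: submodule_span_over\<close>)
qed

lemma noetherian_subfield: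
  assumes "subfield E"
  shows "noetherian_subring E"
  unfolding noetherian_subring_def
proof (intro conjI allI impI)
  show sub: "subring E" using assms by (rule subfield_subring)
  fix I assume I: "I \<subseteq> E" "submodule E I"
  show "\<exists>T. finite T \<and> I = span_over E T"
  proof (cases "I \<subseteq> {0}")
    case True
    then have "I = span_over E {}"
      using submodule_0[OF I(2)] by (auto simp: span_over_def)
    then show ?thesis by blast
  next
    case False
    then obtain a where a: "a \<in> I" "a \<noteq> 0" by auto
    then have "x \<in> I" if "x \<in> E" for x
      using submodule_mult[OF I(2) _ a(1), of "x / a"] I(1) that assms
      by (auto intro: subfield_divide)
    then have "I = E" using I(1) by auto
    then have "I = span_over E {1}"
      by (force simp: span_over_def)
    then show ?thesis by blast
  qed
qed

section \<open>Adjunction and the Hilbert basis theorem\<close>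

definition polys_over :: "'a::comm_ring_1 set \<Rightarrow> 'a poly set" where
  "polys_over R = {p. \<forall>i. coeff p i \<in> R}"

definition adjoin :: "'a::comm_ring_1 set \<Rightarrow> 'a \<Rightarrow> 'a set" where
  "adjoin R x = (\<lambda>p. poly p x) ` polys_over R"

definition generated :: "'a::comm_ring_1 set \<Rightarrow> 'a set" where
  "generated G = \<Inter>{R. subring R \<and> G \<subseteq> R}"

section \<open>Polynomials with coefficients in a subring\<close>

lemma coeff_in_polys_over: "p \<in> polys_over R \<Longrightarrow> coeff p i \<in> R"
  by (simp add: polys_over_def)

lemma subring_polys_over: "subring R \<Longrightarrow> subring (polys_over R)"
  unfolding subring_def[of "polys_over R"]
  by (auto simp: polys_over_def coeff_1 coeff_mult
      intro: subring_0 subring_1 subring_diff subring_mult subring_sum)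

lemma pCons_in_polys_over: "pCons a p \<in> polys_over R \<longleftrightarrow> a \<in> R \<and> p \<in> polys_over R"
  by (auto simp: polys_over_def coeff_pCons split: nat.splits)

lemma const_in_polys_over: "subring R \<Longrightarrow> a \<in> R \<Longrightarrow> [:a:] \<in> polys_over R"
  using subring_0[OF subring_polys_over, of R] by (simp add: pCons_in_polys_over)

lemma monom_in_polys_over: "subring R \<Longrightarrow> a \<in> R \<Longrightarrow> monom a n \<in> polys_over R"
  by (auto simp: polys_over_def subring_0)

lemma smult_in_polys_over: "subring R \<Longrightarrow> a \<in> R \<Longrightarrow> p \<in> polys_over R \<Longrightarrow> smult a p \<in> polys_over R"
  by (auto simp: polys_over_def subring_mult)

lemma polys_over_mono: "Q \<subseteq> R \<Longrightarrow> polys_over Q \<subseteq> polys_over R"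
  by (auto simp: polys_over_def)

lemma adjoinI: "p \<in> polys_over R \<Longrightarrow> poly p x \<in> adjoin R x"
  by (simp add: adjoin_def)

lemma adjoinE:
  assumes "y \<in> adjoin R x"
  obtains p where "p \<in> polys_over R" "y = poly p x"
  using assms by (auto simp: adjoin_def)

lemma adjoin_mono: "Q \<subseteq> R \<Longrightarrow> adjoin Q x \<subseteq> adjoin R x"
  unfolding adjoin_def by (intro image_mono polys_over_mono)

lemma subring_adjoin:
  assumes "subring R"
  shows "subring (adjoin R x)"
  unfolding subring_def[of "adjoin R x"]
proof (intro conjI ballI)
  note P = subring_polys_over[OF assms]
  show "1 \<in> adjoin R x"
    using adjoinI[OF subring_1[OF P]] by simp
  fix y z assume "y \<in> adjoin R x" "z \<in> adjoin R x"
  then obtain p q where "p \<in> polys_over R" "y = poly p x" "q \<in> polys_over R" "z = poly q x"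
    by (metis adjoinE)
  then show "y - z \<in> adjoin R x" "y * z \<in> adjoin R x"
    using adjoinI[OF subring_diff[OF P], of p q x] adjoinI[OF subring_mult[OF P], of p q x]
    by simp_all
qed

lemma subset_adjoin: "subring R \<Longrightarrow> R \<subseteq> adjoin R x"
  using adjoinI[OF const_in_polys_over] by fastforce

lemma self_in_adjoin: "subring R \<Longrightarrow> x \<in> adjoin R x"
  using adjoinI[of "[:0, 1:]" R x]
  by (auto simp: pCons_in_polys_over intro: subring_closed subring_polys_over)

lemma poly_in_subring:
  assumes "subring S" "p \<in> polys_over S" "x \<in> S"
  shows "poly p x \<in> S"
  unfolding poly_altdef using assms
  by (intro subring_sum subring_mult subring_power coeff_in_polys_over)

lemma adjoin_least: "subring S \<Longrightarrow> R \<subseteq> S \<Longrightarrow> x \<in> S \<Longrightarrow> adjoin R x \<subseteq> S"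
  unfolding adjoin_def using polys_over_mono[of R S] poly_in_subring[of S] by blast

section \<open>Subrings generated by a set\<close>

lemma subring_generated: "subring (generated G)"
  by (auto simp: generated_def subring_def)

lemma generated_base: "G \<subseteq> generated G"
  by (auto simp: generated_def)

lemma generated_mem: "x \<in> G \<Longrightarrow> x \<in> generated G"
  using generated_base by blast

lemma generated_least: "subring R \<Longrightarrow> G \<subseteq> R \<Longrightarrow> generated G \<subseteq> R"
  by (auto simp: generated_def)

lemma generated_mono: "G \<subseteq> H \<Longrightarrow> generated G \<subseteq> generated H"
  by (meson generated_base generated_least subring_generated subset_trans)

lemma generated_subring: "subring R \<Longrightarrow> generated R = R"
  by (meson generated_base generated_least subset_antisym subset_refl)

text \<open>Turns statements on generated rings into inductions that adjoin one generator at a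
  time.\<close>

lemma generated_insert: "generated (insert x G) = adjoin (generated G) x"
proof
  show "generated (insert x G) \<subseteq> adjoin (generated G) x"
    using subset_adjoin[OF subring_generated] self_in_adjoin[OF subring_generated]
      generated_base[of G]
    by (intro generated_least subring_adjoin subring_generated) blast+
  show "adjoin (generated G) x \<subseteq> generated (insert x G)"
    using generated_base[of "insert x G"]
    by (intro adjoin_least subring_generated generated_mono) auto
qed

lemma poly_in_span_powers:
  assumes R: "subring R" and p: "p \<in> polys_over R" and "\<And>i. i \<ge> n \<Longrightarrow> coeff p i = 0"
  shows "poly p x \<in> span_over R ((\<lambda>i. x ^ i) ` {..<n})"
proof -
  have "coeff p i * x ^ i \<in> span_over R ((\<lambda>i. x ^ i) ` {..<n})" for i
  proof (cases "i < n")
    case True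
    then show ?thesis
      using p by (intro submodule_mult[OF submodule_span_over[OF R]] span_over_base[OF R])
        (auto intro: coeff_in_polys_over)
  next
    case False
    then show ?thesis
      using assms(3)[of i] submodule_0[OF submodule_span_over[OF R]] by simp
  qed
  then show ?thesis
    unfolding poly_altdef by (intro submodule_sum[OF submodule_span_over[OF R]])
qed

text \<open>Hilbert's basis theorem, for any element \<open>x\<close>, transcendental or not. In the proof the leading
  coefficient of a polynomial of degree at most \<open>n\<close> is its coefficient at \<open>n\<close>, which may vanish.\<close>

theorem noetherian_adjoin:
  assumes noeth: "noetherian_subring R"
  shows "noetherian_subring (adjoin R x)"
  unfolding noetherian_subring_def
proof (intro conjI allI impI)
  note R = noetherian_subring_subring[OF noeth]
  note PR = subring_polys_over[OF R]
  show A: "subring (adjoin R x)"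
    using R by (rule subring_adjoin)
  fix J assume J: "J \<subseteq> adjoin R x" "submodule (adjoin R x) J"
  \<comment> \<open>\<open>J\<close> is lifted to an ideal of polynomials because elements of
    \<open>R[x]\<close> have no well-defined degree if \<open>x\<close> is algebraic.\<close>
  define I where "I = {p \<in> polys_over R. poly p x \<in> J}"
  have I: "submodule (polys_over R) I"
    unfolding submodule_def I_def
    using subring_0[OF PR] subring_add[OF PR] subring_mult[OF PR]
      submodule_0[OF J(2)] submodule_add[OF J(2)] submodule_mult[OF J(2) adjoinI]
    by simp
  define L where "L = {coeff p n | p n. p \<in> I \<and> (\<forall>i>n. coeff p i = 0)}"
  have LI: "coeff p n \<in> L" if "p \<in> I" "\<forall>i>n. coeff p i = 0" for p n
    unfolding L_def using that by blast
  \<comment> \<open>Multiplication by a power of the variable raises the formal degree and keeps the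
    top coefficient, so two polynomials can be brought to a common formal degree before they are
    added.\<close>
  have shift: "monom 1 m * p \<in> I" "coeff (monom 1 m * p) (m + n) = coeff p n"
      "\<forall>i>m+n. coeff (monom 1 m * p) i = 0"
    if "p \<in> I" "\<forall>i>n. coeff p i = 0" for p m n
    using that submodule_mult[OF I monom_in_polys_over[OF R subring_1[OF R]]]
    by (auto simp: coeff_monom_mult)
  have "submodule R L"
    unfolding submodule_def
  proof (intro conjI ballI)
    show "0 \<in> L"
      using LI[OF submodule_0[OF I], of 0] by simp
  next
    fix a b assume "a \<in> L" "b \<in> L"
    then obtain p m q n where pq: "p \<in> I" "\<forall>i>m. coeff p i = 0" "a = coeff p m"
        "q \<in> I" "\<forall>i>n. coeff q i = 0" "b = coeff q n"
      unfolding L_def by blast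
    have "coeff (monom 1 n * p + monom 1 m * q) (m + n) = a + b"
      using shift(2)[OF pq(1,2), of n] shift(2)[OF pq(4,5), of m] pq(3,6)
      by (simp add: add.commute)
    moreover have "monom 1 n * p + monom 1 m * q \<in> I"
      using shift(1) pq by (intro submodule_add[OF I]) blast+
    moreover have "\<forall>i>m+n. coeff (monom 1 n * p + monom 1 m * q) i = 0"
      using shift(3)[OF pq(1,2), of n] shift(3)[OF pq(4,5), of m] by (simp add: add.commute)
    ultimately show "a + b \<in> L"
      using LI by metis
  next
    fix r a assume r: "r \<in> R" and "a \<in> L"
    then obtain p m where p: "p \<in> I" "\<forall>i>m. coeff p i = 0" "a = coeff p m"
      unfolding L_def by blast
    have "[:r:] * p \<in> I"
      using p r by (intro submodule_mult[OF I] const_in_polys_over[OF R])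
    then show "r * a \<in> L"
      using LI[of "[:r:] * p" m] p(2,3) by simp
  qed
  moreover have "L \<subseteq> R"
    by (auto simp: L_def I_def intro: coeff_in_polys_over)
  ultimately obtain S where S: "finite S" "L = span_over R S"
    using noeth unfolding noetherian_subring_def by blast
  have "\<forall>s\<in>S. \<exists>p n. p \<in> I \<and> (\<forall>i>n. coeff p i = 0) \<and> s = coeff p n"
    using span_over_base[OF R S(1)] unfolding S(2)[symmetric] L_def by blast
  then obtain P d where Pd: "\<And>s. s \<in> S \<Longrightarrow> P s \<in> I" "\<And>s. s \<in> S \<Longrightarrow> \<forall>i>d s. coeff (P s) i = 0"
      "\<And>s. s \<in> S \<Longrightarrow> coeff (P s) (d s) = s"
    by metis
  \<comment> \<open>A common bound for the formal degrees; the sum serves as well as the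
    maximum.\<close>
  define N where "N = sum d S"
  have dN: "d s \<le> N" if "s \<in> S" for s
    unfolding N_def using that S(1) by (simp add: member_le_sum)
  define Q where "Q s = monom 1 (N - d s) * P s" for s
  have Q: "Q s \<in> I" "\<forall>i>N. coeff (Q s) i = 0" "coeff (Q s) N = s" if "s \<in> S" for s
    using shift[OF Pd(1,2)[OF that], of "N - d s"] dN[OF that] Pd(3)[OF that]
    by (simp_all add: Q_def)
  \<comment> \<open>The polynomials \<open>Q s\<close> reduce only down to formal degree
    \<open>N\<close>. Below it, \<open>J\<close> meets a finitely generated \<open>R\<close>-module,
    which supplies the remaining generators \<open>H\<close>.\<close>
  have "\<exists>H. finite H \<and> J \<inter> span_over R ((\<lambda>i. x ^ i) ` {..<N}) = span_over R H"
    using submodule_mono[OF J(2) subset_adjoin[OF R]]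
    by (intro noetherian_submodule_fg[OF noeth, of "(\<lambda>i. x ^ i) ` {..<N}"] submodule_Int
        submodule_span_over[OF R]) auto
  then obtain H where H: "finite H"
      "J \<inter> span_over R ((\<lambda>i. x ^ i) ` {..<N}) = span_over R H" by blast
  define G where "G = (\<lambda>s. poly (Q s) x) ` S \<union> H"
  have finG: "finite G" using S(1) H(1) by (simp add: G_def)
  have GJ: "G \<subseteq> J"
    using Q(1) span_over_base[OF R H(1)] H(2) by (auto simp: G_def I_def)
  note sG = submodule_span_over[OF A, of G]
  have low: "poly p x \<in> span_over (adjoin R x) G" if "p \<in> I" "\<forall>i\<ge>N. coeff p i = 0" for p
  proof -
    have "poly p x \<in> span_over R H"
      unfolding H(2)[symmetric] using that poly_in_span_powers[OF R, of p N x]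
      by (auto simp: I_def)
    also have "\<dots> \<subseteq> span_over (adjoin R x) H"
      using subset_adjoin[OF R] by (rule span_over_mono_ring)
    also have "\<dots> \<subseteq> span_over (adjoin R x) G"
      using A finG by (rule span_over_mono) (simp add: G_def)
    finally show ?thesis .
  qed
  have "poly p x \<in> span_over (adjoin R x) G" if "p \<in> I" "\<forall>i\<ge>n. coeff p i = 0" for p n
    using that
  proof (induction n arbitrary: p)
    case 0
    then show ?case using low by auto
  next
    case (Suc n)
    show ?case
    proof (cases "Suc n \<le> N")
      case True
      then show ?thesis using Suc.prems low by auto
    next
      case False
      have "coeff p n \<in> L"
        using LI[of p n] Suc.prems by simp
      then obtain c where c: "\<And>s. s \<in> S \<Longrightarrow> c s \<in> R" "coeff p n = (\<Sum>s\<in>S. c s * s)"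
        unfolding S(2) by (elim span_overE) blast
      \<comment> \<open>\<open>q\<close> has the same coefficient at \<open>n\<close> as
        \<open>p\<close> and none above, so subtracting it lowers the formal bound by one.\<close>
      define q where "q = (\<Sum>s\<in>S. monom (c s) (n - N) * Q s)"
      have "q \<in> I"
        unfolding q_def using c(1) Q(1)
        by (intro submodule_sum[OF I] submodule_mult[OF I] monom_in_polys_over[OF R])
      then have pq: "p - q \<in> I"
        using Suc.prems submodule_diff[OF PR I] by blast
      have coeffq: "coeff q i = (\<Sum>s\<in>S. c s * coeff (Q s) (i - (n - N)))" if "i \<ge> n" for i
        unfolding q_def coeff_sum using that by (intro sum.cong) (auto simp: coeff_monom_mult)
      have "coeff (p - q) i = 0" if "i \<ge> n" for i
      proof (cases "i = n")
        case True
        then show ?thesis using False Q(3) c(2) coeffq[of n] by simp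
      next
        case F: False
        then have "coeff q i = 0"
          unfolding coeffq[OF that] using F that False Q(2) by (intro sum.neutral) auto
        then show ?thesis using Suc.prems(2) F that by simp
      qed
      with pq have 1: "poly (p - q) x \<in> span_over (adjoin R x) G"
        using Suc.IH by blast
      have "poly q x = (\<Sum>s\<in>S. poly (monom (c s) (n - N)) x * poly (Q s) x)"
        by (simp add: q_def poly_sum)
      also have "\<dots> \<in> span_over (adjoin R x) G"
        using c(1) finG
        by (intro submodule_sum[OF sG] submodule_mult[OF sG] span_over_base[OF A]
            adjoinI monom_in_polys_over[OF R]) (auto simp: G_def)
      finally show ?thesis
        using submodule_add[OF sG 1] by fastforce
    qed
  qed
  then have all: "poly p x \<in> span_over (adjoin R x) G" if "p \<in> I" for p
    using that coeff_eq_0[of p] by (metis less_eq_Suc_le)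
  have "J \<subseteq> span_over (adjoin R x) G"
  proof
    fix y assume y: "y \<in> J"
    then obtain p where "p \<in> polys_over R" "y = poly p x"
      using J(1) by (auto simp: adjoin_def)
    then show "y \<in> span_over (adjoin R x) G"
      using all[of p] y by (simp add: I_def)
  qed
  then have "J = span_over (adjoin R x) G"
    using span_over_least[OF J(2) GJ] by blast
  then show "\<exists>T. finite T \<and> J = span_over (adjoin R x) T"
    using finG by blast
qed

lemma noetherian_generated:
  assumes "noetherian_subring R" "finite S"
  shows "noetherian_subring (generated (R \<union> S))"
  using assms(2)
proof (induction S rule: finite_induct)
  case empty
  then show ?case
    using assms(1) generated_subring[OF noetherian_subring_subring[OF assms(1)]] by simp
next
  case (insert s S)
  then show ?case
    using noetherian_adjoin by (simp add: generated_insert)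
qed

section \<open>Integrality\<close>

text \<open>Over a Noetherian ring this is equivalent to integrality, and it makes sums and products
  easy to treat.\<close>

definition finite_over :: "'a::comm_ring_1 set \<Rightarrow> 'a \<Rightarrow> bool" where
  "finite_over R z \<longleftrightarrow> (\<exists>T. finite T \<and> (\<forall>j. z ^ j \<in> span_over R T))"

definition integral_over :: "'a::comm_ring_1 set \<Rightarrow> 'a \<Rightarrow> bool" where
  "integral_over R z \<longleftrightarrow> (\<exists>p\<in>polys_over R. lead_coeff p = 1 \<and> poly p z = 0)"

text \<open>The monic equation rewrites \<open>z ^ j\<close> for \<open>j \<ge> d\<close> through
  lower powers, so the powers below \<open>d\<close> suffice.\<close>

lemma integral_imp_finite_over:
  assumes R: "subring R" and "integral_over R z"
  shows "finite_over R z"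
proof -
  obtain p where p: "p \<in> polys_over R" "lead_coeff p = 1" "poly p z = 0"
    using assms(2) by (auto simp: integral_over_def)
  define d where "d = degree p"
  let ?W = "span_over R ((\<lambda>i. z ^ i) ` {..<d})"
  note sW = submodule_span_over[OF R]
  have "(\<Sum>i\<le>d. coeff p i * z ^ i) = 0"
    using p(3) by (simp add: poly_altdef d_def)
  then have zd: "z ^ d = - (\<Sum>i<d. coeff p i * z ^ i)"
    using p(2) by (simp add: lessThan_Suc_atMost[symmetric] d_def add_eq_0_iff)
  have "z ^ j \<in> ?W" for j
  proof (induction j rule: less_induct)
    case (less j)
    show ?case
    proof (cases "j < d")
      case True
      then show ?thesis using R by (intro span_over_base) auto
    next
      case False
      have "z ^ j = z ^ (j - d) * z ^ d"
        using False by (simp flip: power_add)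
      also have "\<dots> = (\<Sum>i<d. (- coeff p i) * z ^ (j - d + i))"
        by (simp add: zd sum_distrib_left power_add sum_negf mult_ac)
      also have "\<dots> \<in> ?W"
        using less False p(1)
        by (intro submodule_sum[OF sW] submodule_mult[OF sW] subring_uminus[OF R])
           (auto intro: coeff_in_polys_over)
      finally show ?thesis .
    qed
  qed
  then show ?thesis
    unfolding finite_over_def by blast
qed

text \<open>Instead of a determinant: \<open>R[z]\<close> is finitely generated because
  \<open>R\<close> is Noetherian, its generators are polynomials in \<open>z\<close>, and a power of
  \<open>z\<close> beyond their degrees yields a monic relation.\<close>

lemma finite_over_imp_integral:
  assumes noeth: "noetherian_subring R" and "finite_over R z"
  shows "integral_over R z"
proof -
  note R = noetherian_subring_subring[OF noeth]
  obtain T where T: "finite T" "\<And>j. z ^ j \<in> span_over R T"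
    using assms(2) by (auto simp: finite_over_def)
  have "adjoin R z \<subseteq> span_over R T"
    unfolding adjoin_def poly_altdef using T(2)
    by (auto intro!: submodule_sum[OF submodule_span_over[OF R]] coeff_in_polys_over
        submodule_mult[OF submodule_span_over[OF R]])
  then obtain S where S: "finite S" "adjoin R z = span_over R S"
    using noetherian_submodule_fg[OF noeth T(1), of "adjoin R z"]
      submodule_subring[OF subring_adjoin[OF R] subset_adjoin[OF R]] by blast
  have "\<forall>s\<in>S. \<exists>p\<in>polys_over R. s = poly p z"
    using span_over_base[OF R S(1)] unfolding S(2)[symmetric] adjoin_def by auto
  then obtain P where P: "\<And>s. s \<in> S \<Longrightarrow> P s \<in> polys_over R" "\<And>s. s \<in> S \<Longrightarrow> s = poly (P s) z"
    by metis
  \<comment> \<open>Large enough that \<open>q\<close> below cannot touch the leading term of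
    \<open>monom 1 n\<close>.\<close>
  define n where "n = Suc (\<Sum>s\<in>S. degree (P s))"
  have "z ^ n \<in> span_over R S"
    unfolding S(2)[symmetric] using R by (intro subring_power subring_adjoin self_in_adjoin)
  then obtain c where c: "\<And>s. s \<in> S \<Longrightarrow> c s \<in> R" "z ^ n = (\<Sum>s\<in>S. c s * s)"
    by (elim span_overE) blast
  define q where "q = (\<Sum>s\<in>S. smult (c s) (P s))"
  have q: "q \<in> polys_over R"
    unfolding q_def using P(1) c(1)
    by (intro subring_sum subring_polys_over R smult_in_polys_over)
  have "degree q < n"
    unfolding n_def q_def less_Suc_eq_le
    using S(1) by (intro degree_sum_le) (auto intro: order.trans[OF degree_smult_le] member_le_sum)
  then have lead: "lead_coeff (monom 1 n - q) = 1"
    using coeff_eq_0[of q n] degree_add_eq_left[of "- q" "monom 1 n"]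
    by (simp add: degree_monom_eq)
  have "poly q z = (\<Sum>s\<in>S. c s * s)"
    unfolding q_def poly_sum using P(2) by (intro sum.cong) auto
  then have "poly (monom 1 n - q) z = 0"
    using c(2) by (simp add: poly_monom)
  then show ?thesis
    unfolding integral_over_def using lead q
    by (intro bexI[of _ "monom 1 n - q"] subring_diff subring_polys_over R monom_in_polys_over
        subring_1) auto
qed

lemma span_over_tower:
  assumes R: "subring R" and S: "S \<subseteq> span_over R G" and fin: "finite G" "finite T"
  shows "span_over S T \<subseteq> span_over R ((\<lambda>(g, t). g * t) ` (G \<times> T))"
proof
  fix x assume "x \<in> span_over S T"
  then obtain c where c: "\<And>t. t \<in> T \<Longrightarrow> c t \<in> S" "x = (\<Sum>t\<in>T. c t * t)"
    by (elim span_overE) blast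
  have "c t * t \<in> span_over R ((\<lambda>(g, t). g * t) ` (G \<times> T))" if "t \<in> T" for t
  proof (rule span_over_mult_mem[OF submodule_span_over[OF R]])
    show "c t \<in> span_over R G" using c(1)[OF that] S by auto
    show "t \<in> span_over R T" using fin(2) that by (rule span_over_base[OF R])
    fix g u assume "g \<in> G" "u \<in> T"
    then show "g * u \<in> span_over R ((\<lambda>(g, t). g * t) ` (G \<times> T))"
      using fin by (intro span_over_base[OF R]) auto
  qed
  then show "x \<in> span_over R ((\<lambda>(g, t). g * t) ` (G \<times> T))"
    unfolding c(2) by (intro submodule_sum[OF submodule_span_over[OF R]])
qed

lemma finite_over_trans:
  assumes "subring R" "S \<subseteq> span_over R G" "finite G" "finite_over S z"
  shows "finite_over R z"
proof -
  obtain T where T: "finite T" "\<And>j. z ^ j \<in> span_over S T"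
    using assms(4) by (auto simp: finite_over_def)
  then show ?thesis
    using span_over_tower[OF assms(1-3) T(1)] assms(3) unfolding finite_over_def
    by (intro exI[of _ "(\<lambda>(g, t). g * t) ` (G \<times> T)"]) auto
qed

text \<open>Each adjunction multiplies the generators found so far by generators for the powers of
  the new element.\<close>

lemma generated_finite_over:
  assumes R: "subring R" and "finite Y" "\<And>y. y \<in> Y \<Longrightarrow> finite_over R y"
  shows "\<exists>G. finite G \<and> generated (R \<union> Y) \<subseteq> span_over R G"
  using assms(2,3)
proof (induction Y rule: finite_induct)
  case empty
  have "R \<subseteq> span_over R {1}"
    by (force simp: span_over_def)
  then show ?case
    using generated_subring[OF R] by (intro exI[of _ "{1}"]) auto
next
  case (insert y Y)
  then obtain G where G: "finite G" "generated (R \<union> Y) \<subseteq> span_over R G" by auto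
  obtain T where T: "finite T" "\<And>j. y ^ j \<in> span_over R T"
    using insert.prems by (auto simp: finite_over_def)
  let ?H = "(\<lambda>(g, t). g * t) ` (G \<times> T)"
  note sH = submodule_span_over[OF R, of ?H]
  have "poly p y \<in> span_over R ?H" if "p \<in> polys_over (generated (R \<union> Y))" for p
    unfolding poly_altdef
  proof (rule submodule_sum[OF sH])
    fix i
    show "coeff p i * y ^ i \<in> span_over R ?H"
    proof (rule span_over_mult_mem[OF sH])
      show "coeff p i \<in> span_over R G" using coeff_in_polys_over[OF that, of i] G(2) by auto
      show "y ^ i \<in> span_over R T" by (rule T(2))
      fix g u assume "g \<in> G" "u \<in> T"
      then show "g * u \<in> span_over R ?H"
        using G T by (intro span_over_base[OF R]) auto
    qed
  qed
  then have "generated (R \<union> insert y Y) \<subseteq> span_over R ?H"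
    by (auto simp: generated_insert adjoin_def)
  then show ?case using G T by (intro exI[of _ ?H]) auto
qed

lemma finite_over_in_span:
  assumes "subring S" "S \<subseteq> span_over R G" "finite G" "z \<in> S"
  shows "finite_over R z"
  using assms subring_power[OF assms(1,4)] unfolding finite_over_def by blast

text \<open>Differences and products of \<open>x\<close> and \<open>y\<close> lie in the ring
  generated by both over \<open>R\<close>, which sits in a finitely generated module; no equation
  for them has to be found.\<close>

lemma subring_finite_over:
  assumes R: "subring R"
  shows "subring {z. finite_over R z}"
  unfolding subring_def
proof (intro conjI ballI CollectI)
  show "finite_over R 1"
    unfolding finite_over_def using span_over_base[OF R, of "{1}" 1] by (intro exI[of _ "{1}"]) auto
  fix x y assume "x \<in> {z. finite_over R z}" "y \<in> {z. finite_over R z}"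
  then have "\<exists>G. finite G \<and> generated (R \<union> {x, y}) \<subseteq> span_over R G"
    by (intro generated_finite_over R) auto
  then obtain G where G: "finite G" "generated (R \<union> {x, y}) \<subseteq> span_over R G"
    by blast
  have xy: "x \<in> generated (R \<union> {x, y})" "y \<in> generated (R \<union> {x, y})"
    using generated_base[of "R \<union> {x, y}"] by simp_all
  show "finite_over R (x - y)" "finite_over R (x * y)"
    by (intro finite_over_in_span[OF subring_generated G(2,1)]
        subring_diff[OF subring_generated xy] subring_mult[OF subring_generated xy])+
qed

lemma finite_over_self:
  assumes "subring R" "x \<in> R"
  shows "finite_over R x"
proof -
  have "R \<subseteq> span_over R {1}"
    by (force simp: span_over_def)
  then show ?thesis using finite_over_in_span[of R R "{1}"] assms by simp
qed

section \<open>Fractions and algebraic independence\<close>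

definition fractions :: "'a::field set \<Rightarrow> 'a set" where
  "fractions R = {a / b | a b. a \<in> R \<and> b \<in> R}"

definition transcendental_over :: "'a::comm_ring_1 set \<Rightarrow> 'a \<Rightarrow> bool" where
  "transcendental_over E x \<longleftrightarrow> (\<forall>p\<in>polys_over E. poly p x = 0 \<longrightarrow> p = 0)"

text \<open>The usual independence over a subfield \<open>k\<close>, in the form in which a single
  variable is isolated later: each one is transcendental over the field generated by the
  others.\<close>

definition alg_independent :: "'a::field set \<Rightarrow> 'a set \<Rightarrow> bool" where
  "alg_independent k X \<longleftrightarrow>
     (\<forall>x\<in>X. transcendental_over (fractions (generated (k \<union> (X - {x})))) x)"

lemma fractionsI: "a \<in> R \<Longrightarrow> b \<in> R \<Longrightarrow> a / b \<in> fractions R"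
  by (auto simp: fractions_def)

lemma fractionsE:
  assumes "subring R" "x \<in> fractions R"
  obtains a b where "a \<in> R" "b \<in> R" "b \<noteq> 0" "x = a / b"
proof -
  obtain a b where ab: "a \<in> R" "b \<in> R" "x = a / b"
    using assms(2) by (auto simp: fractions_def)
  show ?thesis
  proof (cases "b = 0")
    case True
    then show ?thesis
      using that[of 0 1] ab subring_0[OF assms(1)] subring_1[OF assms(1)] by simp
  qed (use that ab in blast)
qed

lemma subset_fractions: "subring R \<Longrightarrow> R \<subseteq> fractions R"
  using fractionsI[OF _ subring_1] by fastforce

lemma subfield_fractions:
  assumes R: "subring R"
  shows "subfield (fractions R)"
  unfolding subfield_def subring_def
proof (intro conjI ballI)
  show "1 \<in> fractions R"
    using subset_fractions[OF R] subring_1[OF R] by blast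
next
  fix x y assume "x \<in> fractions R" "y \<in> fractions R"
  then obtain a b c d where *: "a \<in> R" "b \<in> R" "b \<noteq> 0" "x = a / b"
      "c \<in> R" "d \<in> R" "d \<noteq> 0" "y = c / d"
    by (metis fractionsE[OF R])
  have "x - y = (a * d - c * b) / (b * d)" "x * y = (a * c) / (b * d)"
    using * by (simp_all add: diff_frac_eq)
  then show "x - y \<in> fractions R" "x * y \<in> fractions R"
    using * by (simp_all add: fractionsI subring_diff[OF R] subring_mult[OF R])
next
  fix x assume "x \<in> fractions R"
  then show "inverse x \<in> fractions R"
    unfolding fractions_def by force
qed

lemma fractions_least: "subfield E \<Longrightarrow> R \<subseteq> E \<Longrightarrow> fractions R \<subseteq> E"
  by (auto simp: fractions_def intro!: subfield_divide)

lemma fractions_mono: "Q \<subseteq> R \<Longrightarrow> fractions Q \<subseteq> fractions R"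
  unfolding fractions_def by blast

lemma common_denominator:
  assumes R: "subring R" and "finite Q" "Q \<subseteq> fractions R"
  obtains g where "g \<in> R" "g \<noteq> 0" "\<And>q. q \<in> Q \<Longrightarrow> g * q \<in> R"
proof -
  have "\<exists>g\<in>R. g \<noteq> 0 \<and> (\<forall>q\<in>Q. g * q \<in> R)"
    using assms(2,3)
  proof (induction Q rule: finite_induct)
    case empty
    then show ?case using subring_1[OF R] by (auto intro!: bexI[of _ 1])
  next
    case (insert q Q)
    then obtain g where g: "g \<in> R" "g \<noteq> 0" "\<And>q. q \<in> Q \<Longrightarrow> g * q \<in> R" by auto
    obtain a b where ab: "a \<in> R" "b \<in> R" "b \<noteq> 0" "q = a / b"
      using insert.prems fractionsE[OF R, of q] by auto
    have "b * g * r \<in> R" if "r \<in> Q" for r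
      using subring_mult[OF R ab(2) g(3)[OF that]] by (simp add: mult.assoc)
    moreover have "b * g * q \<in> R"
      using ab g(1) subring_mult[OF R] by simp
    ultimately show ?case
      using ab g subring_mult[OF R ab(2) g(1)] by (intro bexI[of _ "b * g"]) auto
  qed
  then show ?thesis using that by blast
qed

lemma transcendental_overD:
  "transcendental_over E x \<Longrightarrow> p \<in> polys_over E \<Longrightarrow> poly p x = 0 \<Longrightarrow> p = 0"
  by (simp add: transcendental_over_def)

lemma transcendental_over_mono:
  "transcendental_over E x \<Longrightarrow> D \<subseteq> E \<Longrightarrow> transcendental_over D x"
  unfolding transcendental_over_def using polys_over_mono by blast

lemma alg_independent_mono:
  assumes "alg_independent k X" "Y \<subseteq> X"
  shows "alg_independent k Y"
  unfolding alg_independent_def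
proof
  fix y assume "y \<in> Y"
  then have "transcendental_over (fractions (generated (k \<union> (X - {y})))) y"
    using assms unfolding alg_independent_def by blast
  moreover have "fractions (generated (k \<union> (Y - {y}))) \<subseteq> fractions (generated (k \<union> (X - {y})))"
    using assms(2) by (intro fractions_mono generated_mono) blast
  ultimately show "transcendental_over (fractions (generated (k \<union> (Y - {y})))) y"
    by (rule transcendental_over_mono)
qed

section \<open>Noether normalization\<close>

text \<open>A single term of strictly largest degree cannot be cancelled. Zero summands are listed
  apart because their degree is \<open>0\<close> by convention, which need not be smaller.\<close>

lemma lead_coeff_sum_dominant:
  fixes f :: "'i \<Rightarrow> 'a::comm_ring_1 poly"
  assumes "finite I" "j \<in> I"
    and dom: "\<And>i. i \<in> I \<Longrightarrow> i \<noteq> j \<Longrightarrow> f i = 0 \<or> degree (f i) < degree (f j)"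
  shows "degree (sum f I) = degree (f j)" "lead_coeff (sum f I) = lead_coeff (f j)"
proof -
  have "coeff (sum f I) (degree (f j)) = (\<Sum>i\<in>I. coeff (f i) (degree (f j)))"
    by (simp add: coeff_sum)
  also have "\<dots> = coeff (f j) (degree (f j)) + (\<Sum>i\<in>I - {j}. coeff (f i) (degree (f j)))"
    using assms(1,2) by (rule sum.remove)
  also have "(\<Sum>i\<in>I - {j}. coeff (f i) (degree (f j))) = 0"
    using dom coeff_eq_0[of _ "degree (f j)"] by (intro sum.neutral ballI) force
  finally have c: "coeff (sum f I) (degree (f j)) = lead_coeff (f j)" by simp
  have "degree (f i) \<le> degree (f j)" if "i \<in> I" for i
    using dom[OF that] by (cases "i = j") auto
  then have le: "degree (sum f I) \<le> degree (f j)"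
    using assms(1) by (intro degree_sum_le)
  show d: "degree (sum f I) = degree (f j)"
  proof (cases "f j = 0")
    case True
    then show ?thesis using le by simp
  next
    case False
    then show ?thesis using le c le_degree[of "sum f I" "degree (f j)"] by simp
  qed
  then show "lead_coeff (sum f I) = lead_coeff (f j)"
    using c by simp
qed

text \<open>Nagata's change of variables \<open>y \<mapsto> y - x\<^sup>w\<close>. Each weight is chosen larger than all degrees
  that occur before it, so that the top powers of \<open>x\<close> cannot cancel; the divisibility by \<open>N\<close> keeps
  them apart also after multiplication by different powers \<open>x\<^sup>i\<close> with \<open>i < N\<close>.\<close>

lemma nagata_change_of_variables:
  fixes k :: "'a::field set"
  assumes k: "subfield k" and "finite Y" "finite F" "F \<subseteq> generated (k \<union> Y) - {0}" and N: "0 < N"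
  shows "\<exists>w. \<forall>f\<in>F. \<exists>q\<in>polys_over (generated (k \<union> (\<lambda>y. y - x ^ w y) ` Y)).
    poly q x = f \<and> lead_coeff q \<in> k - {0} \<and> N dvd degree q"
  using assms(2-4)
proof (induction Y arbitrary: F rule: finite_induct)
  case empty
  note ksub = subfield_subring[OF k]
  have "\<exists>q\<in>polys_over k. poly q x = f \<and> lead_coeff q \<in> k - {0} \<and> N dvd degree q" if "f \<in> F" for f
    using empty.prems that generated_subring[OF ksub]
    by (intro bexI[of _ "[:f:]"] const_in_polys_over[OF ksub]) auto
  then show ?case
    using generated_subring[OF ksub] by simp
next
  case (insert y Y)
  have "\<forall>f\<in>F. \<exists>p\<in>polys_over (generated (k \<union> Y)). f = poly p y"
    using insert.prems by (auto simp: generated_insert adjoin_def)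
  then obtain p where p: "\<And>f. f \<in> F \<Longrightarrow> p f \<in> polys_over (generated (k \<union> Y))"
      "\<And>f. f \<in> F \<Longrightarrow> f = poly (p f) y"
    by metis
  \<comment> \<open>All coefficients of all the \<open>p f\<close> go into the induction hypothesis
    at once, so one choice of weights serves every element of \<open>F\<close>.\<close>
  define C where "C = (\<Union>f\<in>F. coeff (p f) ` {..degree (p f)}) - {0}"
  have C: "finite C" "C \<subseteq> generated (k \<union> Y) - {0}"
    unfolding C_def using insert.prems coeff_in_polys_over[OF p(1)] by auto
  from insert.IH[OF this] obtain w where
    "\<forall>f\<in>C. \<exists>q\<in>polys_over (generated (k \<union> (\<lambda>y. y - x ^ w y) ` Y)).
      poly q x = f \<and> lead_coeff q \<in> k - {0} \<and> N dvd degree q" by blast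
  then obtain q where q: "\<And>a. a \<in> C \<Longrightarrow> q a \<in> polys_over (generated (k \<union> (\<lambda>y. y - x ^ w y) ` Y))"
      "\<And>a. a \<in> C \<Longrightarrow> poly (q a) x = a" "\<And>a. a \<in> C \<Longrightarrow> lead_coeff (q a) \<in> k - {0}"
      "\<And>a. a \<in> C \<Longrightarrow> N dvd degree (q a)"
    by metis
  \<comment> \<open>\<open>Suc\<close> makes \<open>M\<close> exceed every degree already present;
    the factor \<open>N\<close> preserves divisibility.\<close>
  define M where "M = N * Suc (\<Sum>a\<in>C. degree (q a))"
  have degq: "degree (q a) < M" if "a \<in> C" for a
  proof -
    have "degree (q a) \<le> (\<Sum>a\<in>C. degree (q a))"
      using C(1) that by (intro member_le_sum) auto
    also have "\<dots> < Suc (\<Sum>a\<in>C. degree (q a))" by simp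
    also have "\<dots> \<le> M" unfolding M_def using N by (cases N) auto
    finally show ?thesis .
  qed
  have M: "0 < M" "N dvd M" using N by (simp_all add: M_def)
  define w' where "w' = w(y := M)"
  define R where "R = generated (k \<union> (\<lambda>y. y - x ^ w' y) ` insert y Y)"
  have R: "subring R" unfolding R_def by (rule subring_generated)
  have im: "(\<lambda>y. y - x ^ w' y) ` insert y Y = insert (y - x ^ M) ((\<lambda>y. y - x ^ w y) ` Y)"
    using insert.hyps by (auto simp: w'_def)
  have base: "y - x ^ M \<in> R"
    unfolding R_def im by (rule generated_mem) simp
  have qR: "q a \<in> polys_over R" if "a \<in> C" for a
  proof -
    have "generated (k \<union> (\<lambda>y. y - x ^ w y) ` Y) \<subseteq> R"
      unfolding R_def im by (intro generated_mono) blast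
    from polys_over_mono[OF this] show ?thesis using q(1)[OF that] by blast
  qed
  \<comment> \<open>This is \<open>y\<close> as a polynomial in \<open>x\<close> over the new ring:
    \<open>y = x ^ M + (y - x ^ M)\<close>.\<close>
  define l where "l = monom 1 M + [:y - x ^ M:]"
  have l: "degree l = M" "lead_coeff l = 1" "poly l x = y" "l \<in> polys_over R"
  proof -
    show "degree l = M"
      unfolding l_def using M(1) by (subst degree_add_eq_left) (auto simp: degree_monom_eq)
    then show "lead_coeff l = 1"
      unfolding l_def using M(1) by (auto simp: coeff_pCons split: nat.splits)
    show "poly l x = y" by (simp add: l_def poly_monom)
    show "l \<in> polys_over R"
      unfolding l_def using base
      by (intro subring_add subring_polys_over R monom_in_polys_over const_in_polys_over subring_1)
  qed
  have "\<exists>h\<in>polys_over R. poly h x = f \<and> lead_coeff h \<in> k - {0} \<and> N dvd degree h" if f: "f \<in> F" for f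
  proof -
    define d where "d = degree (p f)"
    define I where "I = {i. i \<le> d \<and> coeff (p f) i \<noteq> 0}"
    have "p f \<noteq> 0" using p(2)[OF f] insert.prems f by auto
    then have dI: "d \<in> I" by (simp add: I_def d_def)
    have IC: "coeff (p f) i \<in> C" if "i \<in> I" for i
      using that f unfolding C_def I_def d_def by auto
    have "finite I" by (simp add: I_def)
    define t where "t i = l ^ i * q (coeff (p f) i)" for i
    define h where "h = sum t I"
    have degt: "degree (t i) = M * i + degree (q (coeff (p f) i))"
        "lead_coeff (t i) = lead_coeff (q (coeff (p f) i))" if "i \<in> I" for i
    proof -
      have "l \<noteq> 0" using l(2) by auto
      moreover have "q (coeff (p f) i) \<noteq> 0" using q(3)[OF IC[OF that]] by auto
      ultimately show "degree (t i) = M * i + degree (q (coeff (p f) i))"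
        unfolding t_def using l(1) by (simp add: degree_mult_eq degree_power_eq)
      show "lead_coeff (t i) = lead_coeff (q (coeff (p f) i))"
        unfolding t_def using l(2) by (simp only: lead_coeff_mult lead_coeff_power) simp
    qed
    \<comment> \<open>The degree of \<open>t i\<close> is at least \<open>M * i\<close> and less
      than \<open>M * i + M\<close>, so the terms are ordered by \<open>i\<close> alone.\<close>
    have dom: "degree (t i) < degree (t d)" if "i \<in> I" "i \<noteq> d" for i
    proof -
      have "i < d" using that by (auto simp: I_def)
      then have "M * i + M \<le> M * d"
        by (metis Suc_leI mult_Suc_right add.commute mult_le_mono2)
      then show ?thesis
        using degq[OF IC[OF that(1)]] degt[OF that(1)] degt[OF dI] by linarith
    qed
    have "degree h = degree (t d)" "lead_coeff h = lead_coeff (t d)"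
      unfolding h_def by (rule lead_coeff_sum_dominant[OF \<open>finite I\<close> dI]; use dom in blast)+
    then have "N dvd degree h" "lead_coeff h \<in> k - {0}"
      using degt[OF dI] q(3,4)[OF IC[OF dI]] M(2) by simp_all
    moreover have "h \<in> polys_over R"
      unfolding h_def t_def
      by (intro subring_sum subring_mult subring_power subring_polys_over R qR IC l(4))
    moreover have "poly h x = f"
    proof -
      have "poly h x = (\<Sum>i\<in>I. coeff (p f) i * y ^ i)"
        unfolding h_def t_def poly_sum using q(2)[OF IC] l(3)
        by (intro sum.cong) (auto simp: poly_power)
      also have "\<dots> = (\<Sum>i\<le>d. coeff (p f) i * y ^ i)"
        unfolding I_def by (intro sum.mono_neutral_left) auto
      finally show ?thesis
        using p(2)[OF f] by (simp add: poly_altdef d_def)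
    qed
    ultimately show ?thesis by blast
  qed
  then show ?case
    unfolding R_def by blast
qed

text \<open>After the change of variables the relation satisfied by \<open>x\<close> has a leading
  coefficient in \<open>k\<close>. So \<open>x\<close> is integral over the ring of the new
  variables, and each old \<open>y\<close> is recovered from its new variable and a power of
  \<open>x\<close>.\<close>

lemma noether_normalization_step:
  fixes k :: "'a::field set"
  assumes k: "subfield k" and S: "finite S" and dep: "\<not> alg_independent k S"
  shows "\<exists>T. finite T \<and> card T < card S \<and> T \<subseteq> generated (k \<union> S) \<and>
    (\<forall>s\<in>S. finite_over (generated (k \<union> T)) s)"
proof -
  note ksub = subfield_subring[OF k]
  obtain x p0 where x: "x \<in> S" and p0: "p0 \<in> polys_over (fractions (generated (k \<union> (S - {x}))))"
      "poly p0 x = 0" "p0 \<noteq> 0"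
    using dep unfolding alg_independent_def transcendental_over_def by blast
  define Y where "Y = S - {x}"
  have "finite Y" using S by (simp add: Y_def)
  have "coeff p0 ` {..degree p0} \<subseteq> fractions (generated (k \<union> Y))"
    using coeff_in_polys_over[OF p0(1)] by (auto simp: Y_def)
  then obtain g where g: "g \<in> generated (k \<union> Y)" "g \<noteq> 0"
      "\<And>c. c \<in> coeff p0 ` {..degree p0} \<Longrightarrow> g * c \<in> generated (k \<union> Y)"
    by (elim common_denominator[OF subring_generated, rotated]) auto
  define p where "p = smult g p0"
  have p: "poly p x = 0" "p \<noteq> 0" using p0 g(2) by (simp_all add: p_def)
  have pY: "coeff p i \<in> generated (k \<union> Y)" for i
    using g(3)[of "coeff p0 i"] coeff_eq_0[of p0 i] subring_0[OF subring_generated, of "k \<union> Y"]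
    unfolding p_def by (cases "i \<le> degree p0") auto
  \<comment> \<open>Exceeds every exponent \<open>i\<close> of \<open>p\<close>, so that
    \<open>i\<close> can be read off from a degree modulo \<open>N\<close>.\<close>
  define N where "N = Suc (degree p)"
  define I where "I = {i. i \<le> degree p \<and> coeff p i \<noteq> 0}"
  have I: "finite I" "I \<noteq> {}" using p(2) by (auto simp: I_def)
  have "\<exists>w. \<forall>f\<in>coeff p ` I. \<exists>q\<in>polys_over (generated (k \<union> (\<lambda>y. y - x ^ w y) ` Y)).
      poly q x = f \<and> lead_coeff q \<in> k - {0} \<and> N dvd degree q"
    using I pY by (intro nagata_change_of_variables[OF k \<open>finite Y\<close>]) (auto simp: I_def N_def)
  then obtain w where "\<forall>f\<in>coeff p ` I. \<exists>q\<in>polys_over (generated (k \<union> (\<lambda>y. y - x ^ w y) ` Y)).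
      poly q x = f \<and> lead_coeff q \<in> k - {0} \<and> N dvd degree q" by blast
  then have "\<exists>q. \<forall>f\<in>coeff p ` I. q f \<in> polys_over (generated (k \<union> (\<lambda>y. y - x ^ w y) ` Y)) \<and>
      poly (q f) x = f \<and> lead_coeff (q f) \<in> k - {0} \<and> N dvd degree (q f)"
    by (intro bchoice) blast
  then obtain q where q:
      "\<And>a. a \<in> coeff p ` I \<Longrightarrow> q a \<in> polys_over (generated (k \<union> (\<lambda>y. y - x ^ w y) ` Y))"
      "\<And>a. a \<in> coeff p ` I \<Longrightarrow> poly (q a) x = a"
      "\<And>a. a \<in> coeff p ` I \<Longrightarrow> lead_coeff (q a) \<in> k - {0}"
      "\<And>a. a \<in> coeff p ` I \<Longrightarrow> N dvd degree (q a)"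
    by blast
  define T where "T = (\<lambda>y. y - x ^ w y) ` Y"
  define R where "R = generated (k \<union> T)"
  have R: "subring R" unfolding R_def by (rule subring_generated)
  have kR: "k \<subseteq> R" unfolding R_def by (auto intro: generated_mem)
  define t where "t i = monom 1 i * q (coeff p i)" for i
  have degt: "degree (t i) = i + degree (q (coeff p i))"
      "lead_coeff (t i) = lead_coeff (q (coeff p i))" if "i \<in> I" for i
  proof -
    have "q (coeff p i) \<noteq> 0" using q(3) that by force
    then show "degree (t i) = i + degree (q (coeff p i))"
      unfolding t_def by (simp add: degree_mult_eq degree_monom_eq)
    show "lead_coeff (t i) = lead_coeff (q (coeff p i))"
      unfolding t_def by (simp only: lead_coeff_mult) (simp add: degree_monom_eq)
  qed
  have mod: "degree (t i) mod N = i" if i: "i \<in> I" for i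
  proof -
    obtain c where "degree (q (coeff p i)) = N * c"
      using q(4)[OF imageI[OF i]] by (elim dvdE)
    moreover have "i < N" using i by (simp add: I_def N_def)
    ultimately show ?thesis unfolding degt(1)[OF i] by simp
  qed
  have "Max ((\<lambda>i. degree (t i)) ` I) \<in> (\<lambda>i. degree (t i)) ` I"
    using I by (intro Max_in) auto
  then obtain j where j: "j \<in> I" "Max ((\<lambda>i. degree (t i)) ` I) = degree (t j)"
    by blast
  have j_max: "degree (t i) \<le> degree (t j)" if "i \<in> I" for i
    unfolding j(2)[symmetric] using I(1) that by (intro Max_ge) auto
  \<comment> \<open>Equal degrees would give equal residues modulo \<open>N\<close>, so the maximum
    is attained only once.\<close>
  have dom: "degree (t i) < degree (t j)" if "i \<in> I" "i \<noteq> j" for i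
    using j_max[OF that(1)] mod[OF that(1)] mod[OF j(1)] that(2) by (metis le_neq_implies_less)
  define h where "h = sum t I"
  have "lead_coeff h = lead_coeff (t j)"
    unfolding h_def by (rule lead_coeff_sum_dominant[OF I(1) j(1)]; use dom in blast)
  then have lead: "lead_coeff h \<in> k" "lead_coeff h \<noteq> 0"
    using degt[OF j(1)] q(3) j(1) by auto
  have hR: "h \<in> polys_over R"
    unfolding h_def t_def R_def T_def
    by (intro subring_sum subring_mult subring_polys_over subring_generated monom_in_polys_over
        subring_1 q(1) imageI)
  have "poly h x = (\<Sum>i\<in>I. coeff p i * x ^ i)"
    unfolding h_def t_def poly_sum using q(2)
    by (intro sum.cong) (auto simp: poly_monom)
  also have "\<dots> = (\<Sum>i\<le>degree p. coeff p i * x ^ i)"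
    unfolding I_def by (intro sum.mono_neutral_left) auto
  also have "\<dots> = 0" using p(1) by (simp add: poly_altdef)
  finally have "poly h x = 0" .
  then have "integral_over R x"
    unfolding integral_over_def using lead hR subfield_inverse[OF k] kR
    by (intro bexI[of _ "smult (inverse (lead_coeff h)) h"] smult_in_polys_over[OF R]) auto
  then have finx: "finite_over R x"
    by (rule integral_imp_finite_over[OF R])
  have finR: "finite_over R r" if "r \<in> R" for r
    using finite_over_self[OF R that] .
  have "finite_over R s" if "s \<in> S" for s
  proof (cases "s = x")
    case True
    then show ?thesis using finx by simp
  next
    case False
    then have "s - x ^ w s \<in> R"
      unfolding R_def T_def Y_def using that by (intro generated_mem) blast
    then have "(s - x ^ w s) + x ^ w s \<in> {z. finite_over R z}"
      using finx finR by (intro subring_add subring_power subring_finite_over[OF R]) auto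
    then show ?thesis by simp
  qed
  moreover have "T \<subseteq> generated (k \<union> S)"
  proof
    fix z assume "z \<in> T"
    then obtain y where y: "y \<in> S" "z = y - x ^ w y" by (auto simp: T_def Y_def)
    have "y \<in> generated (k \<union> S)" "x \<in> generated (k \<union> S)"
      using x y by (auto intro: generated_mem)
    then show "z \<in> generated (k \<union> S)"
      unfolding y(2) by (intro subring_diff subring_power subring_generated)
  qed
  moreover have "card T < card S"
  proof -
    have "card T \<le> card Y" unfolding T_def using \<open>finite Y\<close> by (rule card_image_le)
    also have "\<dots> < card S" unfolding Y_def using S x by (rule card_Diff1_less)
    finally show ?thesis .
  qed
  ultimately show ?thesis
    using \<open>finite Y\<close> unfolding R_def by (intro exI[of _ T]) (auto simp: T_def)
qed

text \<open>Induction on the number of generators: a dependent set is replaced by a smaller one over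
  which it is finite, and finiteness is transitive.\<close>

theorem noether_normalization:
  fixes k :: "'a::field set"
  assumes k: "subfield k" and "finite S"
  shows "\<exists>X. finite X \<and> alg_independent k X \<and> X \<subseteq> generated (k \<union> S) \<and>
    (\<forall>s\<in>S. finite_over (generated (k \<union> X)) s)"
  using assms(2)
proof (induction "card S" arbitrary: S rule: less_induct)
  case less
  show ?case
  proof (cases "alg_independent k S")
    case True
    have "S \<subseteq> generated (k \<union> S)" by (auto intro: generated_mem)
    then show ?thesis
      using True less.prems finite_over_self[OF subring_generated] by blast
  next
    case False
    then obtain T where T: "finite T" "card T < card S" "T \<subseteq> generated (k \<union> S)"
        "\<And>s. s \<in> S \<Longrightarrow> finite_over (generated (k \<union> T)) s"
      using noether_normalization_step[OF k less.prems] by blast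
    obtain X where X: "finite X" "alg_independent k X" "X \<subseteq> generated (k \<union> T)"
        "\<And>t. t \<in> T \<Longrightarrow> finite_over (generated (k \<union> X)) t"
      using less.hyps[OF T(2,1)] by blast
    define P where "P = generated (k \<union> X)"
    have P: "subring P" "k \<subseteq> P"
      unfolding P_def by (auto intro: subring_generated generated_mem)
    obtain G where G: "finite G" "generated (P \<union> T) \<subseteq> span_over P G"
      using generated_finite_over[OF P(1) T(1)] X(4) unfolding P_def by blast
    have "generated (k \<union> T) \<subseteq> generated (P \<union> T)"
      using P(2) by (intro generated_mono) blast
    then have "finite_over P s" if "s \<in> S" for s
      using G T(4)[OF that] by (intro finite_over_trans[OF P(1) _ G(1), of "generated (k \<union> T)"]) auto
    moreover have "k \<union> T \<subseteq> generated (k \<union> S)"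
      using T(3) by (auto intro: generated_mem)
    then have "X \<subseteq> generated (k \<union> S)"
      using X(3) generated_least[OF subring_generated] by blast
    ultimately show ?thesis
      using X(1,2) unfolding P_def by blast
  qed
qed

section \<open>Almost integral elements over a polynomial ring in one variable\<close>

definition lin_independent :: "'a::comm_ring_1 set \<Rightarrow> 'a set \<Rightarrow> bool" where
  "lin_independent F B \<longleftrightarrow>
     (\<forall>c. (\<forall>b\<in>B. c b \<in> F) \<longrightarrow> (\<Sum>b\<in>B. c b * b) = 0 \<longrightarrow> (\<forall>b\<in>B. c b = 0))"

lemma lin_independent_coeff_eq:
  assumes "lin_independent F B" "subring F"
    and "\<And>b. b \<in> B \<Longrightarrow> c b \<in> F" "\<And>b. b \<in> B \<Longrightarrow> d b \<in> F"
    and "(\<Sum>b\<in>B. c b * b) = (\<Sum>b\<in>B. d b * b)" "b \<in> B"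
  shows "c b = d b"
proof -
  have "(\<Sum>b\<in>B. (c b - d b) * b) = 0"
    using assms(5) by (simp add: left_diff_distrib sum_subtractf)
  moreover have "\<forall>b\<in>B. c b - d b \<in> F"
    using assms(2-4) subring_diff by blast
  ultimately have "\<forall>b\<in>B. c b - d b = 0"
    using assms(1) unfolding lin_independent_def by (elim allE[of _ "\<lambda>b. c b - d b"]) blast
  then show ?thesis using assms(6) by simp
qed

text \<open>Redundant vectors are discarded one by one. Staying inside \<open>G\<close> matters:
  \<open>G\<close> will consist of elements of \<open>A\<close>, and the basis vectors have to be
  integral.\<close>

lemma spanning_set_contains_basis:
  fixes F :: "'a::field set"
  assumes F: "subfield F" and "finite G"
  shows "\<exists>B\<subseteq>G. lin_independent F B \<and> span_over F G = span_over F B"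
  using assms(2)
proof (induction "card G" arbitrary: G rule: less_induct)
  case less
  note Fsub = subfield_subring[OF F]
  show ?case
  proof (cases "lin_independent F G")
    case True
    then show ?thesis by blast
  next
    case False
    then obtain c b where c: "\<And>g. g \<in> G \<Longrightarrow> c g \<in> F" "(\<Sum>g\<in>G. c g * g) = 0"
        and b: "b \<in> G" "c b \<noteq> 0"
      unfolding lin_independent_def by blast
    have fin: "finite (G - {b})" using less.prems by simp
    have "c b * b + (\<Sum>g\<in>G - {b}. c g * g) = 0"
      using c(2) sum.remove[OF less.prems b(1), of "\<lambda>g. c g * g"] by simp
    then have "c b * b = - (\<Sum>g\<in>G - {b}. c g * g)"
      by (simp add: add_eq_0_iff)
    then have "b = (- inverse (c b)) * (\<Sum>g\<in>G - {b}. c g * g)"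
      using b(2) by (simp add: field_simps)
    also have "\<dots> \<in> span_over F (G - {b})"
      using c(1) b
      by (intro submodule_mult[OF submodule_span_over[OF Fsub]] span_overI
          subring_uminus[OF Fsub] subfield_inverse[OF F]) auto
    finally have "b \<in> span_over F (G - {b})" .
    then have "G \<subseteq> span_over F (G - {b})"
      using span_over_base[OF Fsub fin] by blast
    then have eq: "span_over F G = span_over F (G - {b})"
      using span_over_least[OF submodule_span_over[OF Fsub]] span_over_mono[OF Fsub less.prems]
      by (intro subset_antisym) auto
    have "card (G - {b}) < card G"
      using less.prems b(1) by (rule card_Diff1_less)
    from less.hyps[OF this fin] eq show ?thesis by blast
  qed
qed

locale transcendental_element =
  fixes E :: "'a::field set" and x :: 'a
  assumes subfield: "subfield E" and transcendental: "transcendental_over E x"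
begin

lemma E_subring: "subring E"
  using subfield by (rule subfield_subring)

lemmas polys_subring = subring_polys_over[OF E_subring]

lemma poly_nonzero: "p \<in> polys_over E \<Longrightarrow> p \<noteq> 0 \<Longrightarrow> poly p x \<noteq> 0"
  using transcendental_overD[OF transcendental] by blast

lemma X_in_polys: "[:0, 1:] \<in> polys_over E"
  using E_subring by (simp add: pCons_in_polys_over subring_0 subring_1 subring_0[OF polys_subring])

lemma x_nonzero: "x \<noteq> 0"
  using poly_nonzero[OF X_in_polys] by simp

text \<open>The valuation ring of \<open>E(x)\<close> at the place \<open>x = \<infinity>\<close>; its uniformizer is \<open>1 / x\<close> and its residue
  field is \<open>E\<close>.\<close>

definition V :: "'a set" where
  "V = {poly p x / poly q x | p q.
     p \<in> polys_over E \<and> q \<in> polys_over E \<and> q \<noteq> 0 \<and> degree p \<le> degree q}"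

lemma VI:
  "p \<in> polys_over E \<Longrightarrow> q \<in> polys_over E \<Longrightarrow> q \<noteq> 0 \<Longrightarrow> degree p \<le> degree q \<Longrightarrow>
    poly p x / poly q x \<in> V"
  unfolding V_def by blast

lemma VE:
  assumes "v \<in> V"
  obtains p q where "p \<in> polys_over E" "q \<in> polys_over E" "q \<noteq> 0" "degree p \<le> degree q"
    "v = poly p x / poly q x"
  using assms unfolding V_def by blast

lemma V_subring: "subring V"
  unfolding subring_def
proof (intro conjI ballI)
  show "1 \<in> V"
    using VI[of 1 1] subring_1[OF polys_subring] by simp
next
  fix u v assume "u \<in> V" "v \<in> V"
  then obtain p q p' q' where *: "p \<in> polys_over E" "q \<in> polys_over E" "q \<noteq> 0"
      "degree p \<le> degree q" "u = poly p x / poly q x" "p' \<in> polys_over E" "q' \<in> polys_over E"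
      "q' \<noteq> 0" "degree p' \<le> degree q'" "v = poly p' x / poly q' x"
    by (metis VE)
  have nz: "poly q x \<noteq> 0" "poly q' x \<noteq> 0" using * poly_nonzero by auto
  have deg: "degree (q * q') = degree q + degree q'"
    using * by (simp add: degree_mult_eq)
  have "degree (p * q' - p' * q) \<le> degree (q * q')"
    unfolding deg using * degree_mult_le[of p q'] degree_mult_le[of p' q]
    by (intro degree_diff_le) linarith+
  then have "poly (p * q' - p' * q) x / poly (q * q') x \<in> V"
    using * by (intro VI subring_diff[OF polys_subring] subring_mult[OF polys_subring]) auto
  moreover have "poly (p * q' - p' * q) x / poly (q * q') x = u - v"
    using * nz by (simp add: diff_frac_eq)
  ultimately show "u - v \<in> V" by simp
  have "degree (p * p') \<le> degree (q * q')"
    unfolding deg using * degree_mult_le[of p p'] by linarith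
  then have "poly (p * p') x / poly (q * q') x \<in> V"
    using * by (intro VI subring_mult[OF polys_subring]) auto
  then show "u * v \<in> V" using * by simp
qed

lemma E_subset_V: "E \<subseteq> V"
proof
  fix e assume "e \<in> E"
  then show "e \<in> V"
    using VI[of "[:e:]" 1] const_in_polys_over[OF E_subring] subring_1[OF polys_subring] by simp
qed

lemma inverse_x_in_V: "1 / x ^ n \<in> V"
proof -
  have "1 / x \<in> V"
    using VI[OF subring_1[OF polys_subring] X_in_polys] by simp
  from subring_power[OF V_subring this] show ?thesis
    by (simp add: power_one_over)
qed

lemma V_subset_fractions: "V \<subseteq> fractions (adjoin E x)"
  by (auto elim!: VE intro!: fractionsI adjoinI)

text \<open>Subtracting from \<open>v\<close> its value at infinity leaves a multiple of the
  uniformizer; iteration gives the expansion of \<open>v\<close> in powers of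
  \<open>1 / x\<close>.\<close>

lemma V_residue:
  assumes "v \<in> V"
  obtains e u where "e \<in> E" "u \<in> V" "v = e + u / x"
proof -
  obtain p q where *: "p \<in> polys_over E" "q \<in> polys_over E" "q \<noteq> 0" "degree p \<le> degree q"
      "v = poly p x / poly q x"
    using assms by (rule VE)
  \<comment> \<open>The numerator is read at \<open>degree q\<close>, not at its own degree: the
    value is \<open>0\<close> when \<open>degree p < degree q\<close>.\<close>
  define e where "e = coeff p (degree q) / lead_coeff q"
  define r where "r = p - smult e q"
  have e: "e \<in> E"
    unfolding e_def using * by (intro subfield_divide[OF subfield] coeff_in_polys_over)
  have r: "r \<in> polys_over E"
    unfolding r_def using * e
    by (intro subring_diff[OF polys_subring] smult_in_polys_over[OF E_subring])
  have "coeff r (degree q) = 0"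
    using *(3) by (simp add: r_def e_def)
  moreover have "degree r \<le> degree q"
    unfolding r_def using *(4) by (intro degree_diff_le) auto
  ultimately have "r = 0 \<or> degree r < degree q"
    by (metis leading_coeff_0_iff le_neq_implies_less)
  then have "degree (pCons 0 r) \<le> degree q"
    by (auto simp: degree_pCons_eq_if)
  then have "poly (pCons 0 r) x / poly q x \<in> V"
    using * r by (intro VI) (auto simp: pCons_in_polys_over subring_0[OF E_subring])
  moreover have "v = e + (poly (pCons 0 r) x / poly q x) / x"
    using * x_nonzero poly_nonzero[OF *(2,3)] by (simp add: r_def field_simps)
  ultimately show ?thesis using that e by blast
qed

text \<open>A nonzero polynomial in \<open>x\<close> does not vanish at infinity; degrees are
  compared after clearing the denominator.\<close>

lemma adjoin_pole:
  assumes "a \<in> adjoin E x" "a * x \<in> V"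
  shows "a = 0"
proof (rule ccontr)
  assume "a \<noteq> 0"
  obtain r where r: "r \<in> polys_over E" "a = poly r x"
    using assms(1) by (rule adjoinE)
  obtain p q where *: "p \<in> polys_over E" "q \<in> polys_over E" "q \<noteq> 0" "degree p \<le> degree q"
      "a * x = poly p x / poly q x"
    using assms(2) by (rule VE)
  have "poly (pCons 0 r * q - p) x = 0"
    using * r poly_nonzero[OF *(2,3)] by (simp add: field_simps)
  moreover have "pCons 0 r * q - p \<in> polys_over E"
    using r * by (intro subring_diff[OF polys_subring] subring_mult[OF polys_subring])
      (auto simp: pCons_in_polys_over subring_0[OF E_subring])
  ultimately have "pCons 0 r * q = p"
    using transcendental_overD[OF transcendental] by fastforce
  moreover have "r \<noteq> 0" using r \<open>a \<noteq> 0\<close> by auto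
  then have "degree (pCons 0 r * q) = Suc (degree r) + degree q"
    using *(3) by (subst degree_mult_eq) auto
  ultimately show False using *(4) by simp
qed

lemma fractions_bounded_pole:
  assumes "f \<in> fractions (adjoin E x)"
  shows "\<exists>n. f / x ^ n \<in> V"
proof -
  obtain a b where ab: "a \<in> adjoin E x" "b \<in> adjoin E x" "b \<noteq> 0" "f = a / b"
    using fractionsE[OF subring_adjoin[OF E_subring] assms] .
  obtain p q where pq: "p \<in> polys_over E" "a = poly p x" "q \<in> polys_over E" "b = poly q x"
    using ab by (metis adjoinE)
  have "q \<noteq> 0" using ab pq by auto
  \<comment> \<open>A crude pole bound: since \<open>q\<close> is nonzero, dividing by the full
    degree of the numerator is enough.\<close>
  have "poly p x / poly (q * monom 1 (degree p)) x \<in> V"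
    using pq \<open>q \<noteq> 0\<close>
    by (intro VI subring_mult[OF polys_subring] monom_in_polys_over[OF E_subring]
        subring_1[OF E_subring]) (auto simp: degree_mult_eq degree_monom_eq monom_eq_0_iff)
  then show ?thesis
    using ab pq by (intro exI[of _ "degree p"]) (simp add: poly_monom)
qed

text \<open>Residues are split off one at a time; each contributes a monomial to the polynomial part
  of the expansion at infinity.\<close>

lemma polar_part:
  assumes "v \<in> V"
  shows "\<exists>a\<in>adjoin E x. \<exists>u\<in>V. x ^ n * v = a + u"
  using assms
proof (induction n arbitrary: v)
  case 0
  then show ?case
    using subring_0[OF subring_adjoin[OF E_subring]] by force
next
  case (Suc n)
  obtain e u where eu: "e \<in> E" "u \<in> V" "v = e + u / x"
    using Suc.prems by (rule V_residue)
  obtain a u' where au: "a \<in> adjoin E x" "u' \<in> V" "x ^ n * u = a + u'"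
    using Suc.IH[OF eu(2)] by blast
  have "x ^ Suc n * v = x ^ Suc n * e + x ^ n * u"
    using x_nonzero by (simp add: eu(3) field_simps)
  then have "x ^ Suc n * v = (x ^ Suc n * e + a) + u'"
    by (simp add: au(3))
  moreover have "x ^ Suc n * e + a \<in> adjoin E x"
    using eu(1) au(1) subset_adjoin[OF E_subring] self_in_adjoin[OF E_subring]
    by (intro subring_add subring_mult subring_power subring_adjoin[OF E_subring]) auto
  ultimately show ?case using au(2) by blast
qed

end

text \<open>Here \<open>N\<close> stands for the integral closure after inverting the nonzero
  polynomials in the other variables. The argument at infinity sees it as an \<open>E\<close>-space
  that contains the lattice and has a common denominator for the powers of each element.\<close>

locale almost_integral_module = transcendental_element +
  fixes B N :: "'a::field set"
  assumes finite_B: "finite B"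
    and independent: "lin_independent (fractions (adjoin E x)) B"
    and mult_B: "\<And>b c. b \<in> B \<Longrightarrow> c \<in> B \<Longrightarrow> b * c \<in> span_over (fractions (adjoin E x)) B"
    and N_span: "N \<subseteq> span_over (fractions (adjoin E x)) B"
    and N_submodule: "submodule E N"
    and lattice_N: "span_over (adjoin E x) B \<subseteq> N"
    and almost_integral:
      "\<And>z. z \<in> N \<Longrightarrow> \<exists>g\<in>adjoin E x. g \<noteq> 0 \<and> (\<forall>j. g * z ^ j \<in> span_over (adjoin E x) B)"
begin

text \<open>The counterpart at infinity of the lattice \<open>span_over (adjoin E x) B\<close>:
  \<open>z * x ^ n \<in> M\<close> says that the coordinates of \<open>z\<close> vanish there to
  order at least \<open>n\<close>.\<close>

definition M :: "'a set" where
  "M = span_over V B"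

lemma M_submodule: "submodule V M"
  unfolding M_def using V_subring by (rule submodule_span_over)

lemma F_subring: "subring (fractions (adjoin E x))"
  by (intro subfield_subring subfield_fractions subring_adjoin E_subring)

lemma M_shrink: "m \<in> M \<Longrightarrow> m / x ^ n \<in> M"
  using submodule_mult[OF M_submodule inverse_x_in_V, of m n] by simp

section \<open>Poles and zeros at infinity\<close>

lemma span_bounded_pole:
  assumes "z \<in> span_over (fractions (adjoin E x)) B"
  shows "\<exists>n. z / x ^ n \<in> M"
proof -
  obtain c where c: "\<And>b. b \<in> B \<Longrightarrow> c b \<in> fractions (adjoin E x)" "z = (\<Sum>b\<in>B. c b * b)"
    using assms by (elim span_overE) blast
  obtain n where n: "\<And>b. b \<in> B \<Longrightarrow> c b / x ^ n b \<in> V"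
    using fractions_bounded_pole[OF c(1)] by metis
  define m where "m = sum n B"
  have "c b / x ^ m \<in> V" if "b \<in> B" for b
  proof -
    have "n b \<le> m"
      unfolding m_def using finite_B that by (intro member_le_sum) auto
    then have "c b / x ^ m = (c b / x ^ n b) * (1 / x ^ (m - n b))"
      by (simp flip: power_add)
    then show ?thesis
      using subring_mult[OF V_subring n[OF that] inverse_x_in_V, of "m - n b"] by (simp only:)
  qed
  then have "(\<Sum>b\<in>B. c b / x ^ m * b) \<in> M"
    unfolding M_def by (rule span_overI)
  then show ?thesis
    by (auto simp: c(2) sum_divide_distrib)
qed

text \<open>\<open>M\<close> need not be a ring. The products of basis vectors are finitely many, so
  their poles at infinity are bounded, and \<open>C\<close> is the price of one
  multiplication.\<close>

lemma M_mult_bounded_pole: "\<exists>C. \<forall>m\<in>M. \<forall>m'\<in>M. m * m' / x ^ C \<in> M"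
proof -
  have "\<forall>p\<in>B \<times> B. \<exists>n. fst p * snd p / x ^ n \<in> M"
    using span_bounded_pole mult_B by auto
  then obtain n where n: "\<And>p. p \<in> B \<times> B \<Longrightarrow> fst p * snd p / x ^ n p \<in> M"
    by metis
  define C where "C = sum n (B \<times> B)"
  have *: "b * c \<in> {u. u * (1 / x ^ C) \<in> M}" if "b \<in> B" "c \<in> B" for b c
  proof -
    have "n (b, c) \<le> C"
      unfolding C_def using finite_B that by (intro member_le_sum) auto
    then have "b * c * (1 / x ^ C) = b * c / x ^ n (b, c) / x ^ (C - n (b, c))"
      by (simp flip: power_add)
    moreover have "b * c / x ^ n (b, c) / x ^ (C - n (b, c)) \<in> M"
      using M_shrink[OF n[of "(b, c)"]] that by simp
    ultimately show ?thesis by (simp only: mem_Collect_eq)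
  qed
  have "m * m' / x ^ C \<in> M" if "m \<in> M" "m' \<in> M" for m m'
    using span_over_mult_mem[OF submodule_quotient[OF M_submodule] *] that
    unfolding M_def by simp
  then show ?thesis by blast
qed

text \<open>Comparison of coordinates reduces this to \<open>adjoin_pole\<close>. Geometrically, a
  trivial bundle on the projective line twisted by \<open>-1\<close> has no sections.\<close>

lemma lattice_Int_M:
  assumes "l \<in> span_over (adjoin E x) B" "l * x \<in> M"
  shows "l = 0"
proof -
  obtain a where a: "\<And>b. b \<in> B \<Longrightarrow> a b \<in> adjoin E x" "l = (\<Sum>b\<in>B. a b * b)"
    using assms(1) by (elim span_overE) blast
  obtain v where v: "\<And>b. b \<in> B \<Longrightarrow> v b \<in> V" "l * x = (\<Sum>b\<in>B. v b * b)"
    using assms(2) unfolding M_def by (elim span_overE) blast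
  note sub = subset_fractions[OF subring_adjoin[OF E_subring]]
  have "a b * x = v b" if "b \<in> B" for b
  proof (rule lin_independent_coeff_eq[OF independent F_subring _ _ _ that])
    show "(\<Sum>b\<in>B. a b * x * b) = (\<Sum>b\<in>B. v b * b)"
      unfolding v(2)[symmetric] a(2) sum_distrib_right by (intro sum.cong) (simp_all add: mult_ac)
    fix c assume "c \<in> B"
    then show "a c * x \<in> fractions (adjoin E x)" "v c \<in> fractions (adjoin E x)"
      using subring_mult[OF F_subring, of "a c" x] subsetD[OF sub self_in_adjoin[OF E_subring]]
        subsetD[OF sub a(1)] subsetD[OF V_subset_fractions v(1)]
      by simp_all
  qed
  then have "a b = 0" if "b \<in> B" for b
    using adjoin_pole[OF a(1)[OF that]] v(1)[OF that] that by simp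
  then show ?thesis by (simp add: a(2))
qed

text \<open>An element of \<open>N\<close> with a zero of high order at infinity has powers whose order of vanishing
  grows, while a common denominator brings all of them into the lattice.\<close>

lemma N_vanishing: "\<exists>C. \<forall>z\<in>N. z * x ^ C \<in> M \<longrightarrow> z = 0"
proof -
  obtain C where C: "\<And>m m'. m \<in> M \<Longrightarrow> m' \<in> M \<Longrightarrow> m * m' / x ^ C \<in> M"
    using M_mult_bounded_pole by blast
  \<comment> \<open>A product of \<open>Suc j\<close> factors takes \<open>j\<close>
    multiplications, each costing \<open>x ^ C\<close>.\<close>
  have pow: "w ^ Suc j / x ^ (C * j) \<in> M" if "w \<in> M" for w j
  proof (induction j)
    case (Suc j)
    have "w ^ Suc (Suc j) / x ^ (C * Suc j) = (w ^ Suc j / x ^ (C * j)) * w / x ^ C"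
      by (simp add: power_add mult_ac)
    then show ?case using C[OF Suc that] by simp
  qed (use that in simp)
  \<comment> \<open>Vanishing to order \<open>Suc C\<close> beats the cost of a multiplication by
    one, so the order of the powers keeps growing.\<close>
  have "z = 0" if z: "z \<in> N" "z * x ^ Suc C \<in> M" for z
  proof -
    obtain g where g: "g \<in> adjoin E x" "g \<noteq> 0" "\<And>j. g * z ^ j \<in> span_over (adjoin E x) B"
      using almost_integral[OF z(1)] by blast
    obtain D where D: "g / x ^ D \<in> V"
      using fractions_bounded_pole g(1) subset_fractions[OF subring_adjoin[OF E_subring]] by blast
    \<comment> \<open>The order left after \<open>D\<close> multiplications is
      \<open>(C + 1) * (D + 1) - C * D = C + D + 1\<close>. The pole of \<open>g\<close> takes away
      at most \<open>D\<close>, a further \<open>C\<close> is given up, and exactly the one order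
      asked for by \<open>lattice_Int_M\<close> remains.\<close>
    have "(z * x ^ Suc C) ^ Suc D / x ^ (C * D) = z ^ Suc D * (x ^ (Suc C * Suc D) / x ^ (C * D))"
      by (simp only: power_mult_distrib power_mult times_divide_eq_right)
    also have "x ^ (Suc C * Suc D) / x ^ (C * D) = x ^ (C + D + 1)"
      using x_nonzero by (simp add: power_add[symmetric] divide_eq_eq algebra_simps)
    finally have "z ^ Suc D * x ^ (C + D + 1) \<in> M"
      using pow[OF z(2), of D] by simp
    then have "g / x ^ D * (z ^ Suc D * x ^ (C + D + 1)) / x ^ C \<in> M"
      by (intro M_shrink submodule_mult[OF M_submodule D])
    also have "g / x ^ D * (z ^ Suc D * x ^ (C + D + 1)) / x ^ C = g * z ^ Suc D * x"
      using x_nonzero by (simp add: power_add field_simps)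
    finally have "g * z ^ Suc D = 0"
      using lattice_Int_M[OF g(3)] by blast
    then show ?thesis using g(2) by auto
  qed
  then show ?thesis by blast
qed

text \<open>Expanding the coordinates in powers of \<open>1 / x\<close>, each further order adds
  only the finitely many vectors \<open>b / x ^ n\<close> to the generators.\<close>

lemma M_expansion: "\<exists>G. finite G \<and> (\<forall>m\<in>M. \<exists>g\<in>span_over E G. \<exists>m'\<in>M. m = g + m' / x ^ n)"
proof (induction n)
  case 0
  show ?case
    using submodule_0[OF submodule_span_over[OF E_subring, of "{}"]]
    by (intro exI[of _ "{}"]) force
next
  case (Suc n)
  then obtain G where G: "finite G" "\<And>m. m \<in> M \<Longrightarrow> \<exists>g\<in>span_over E G. \<exists>m'\<in>M. m = g + m' / x ^ n"
    by blast
  define H where "H = G \<union> (\<lambda>b. b / x ^ n) ` B"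
  have H: "finite H" using G(1) finite_B by (simp add: H_def)
  note sH = submodule_span_over[OF E_subring, of H]
  have "\<exists>g\<in>span_over E H. \<exists>m'\<in>M. m = g + m' / x ^ Suc n" if m: "m \<in> M" for m
  proof -
    obtain g m' where g: "g \<in> span_over E G" "m' \<in> M" "m = g + m' / x ^ n"
      using G(2)[OF m] by blast
    obtain v where v: "\<And>b. b \<in> B \<Longrightarrow> v b \<in> V" "m' = (\<Sum>b\<in>B. v b * b)"
      using g(2) unfolding M_def by (elim span_overE) blast
    have "\<forall>b\<in>B. \<exists>e u. e \<in> E \<and> u \<in> V \<and> v b = e + u / x"
      using v(1) by (metis V_residue)
    then obtain e u where eu: "\<And>b. b \<in> B \<Longrightarrow> e b \<in> E" "\<And>b. b \<in> B \<Longrightarrow> u b \<in> V"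
        "\<And>b. b \<in> B \<Longrightarrow> v b = e b + u b / x"
      by metis
    have "m' = (\<Sum>b\<in>B. e b * b + u b * b / x)"
      unfolding v(2) by (intro sum.cong) (auto simp: eu(3) distrib_right)
    then have "m' = (\<Sum>b\<in>B. e b * b) + (\<Sum>b\<in>B. u b * b) / x"
      by (simp add: sum.distrib sum_divide_distrib)
    then have "m = (g + (\<Sum>b\<in>B. e b * (b / x ^ n))) + (\<Sum>b\<in>B. u b * b) / x ^ Suc n"
      by (simp add: g(3) add_divide_distrib sum_divide_distrib)
    moreover have "(\<Sum>b\<in>B. u b * b) \<in> M"
      unfolding M_def using eu(2) by (rule span_overI)
    moreover have "g + (\<Sum>b\<in>B. e b * (b / x ^ n)) \<in> span_over E H"
    proof (intro submodule_add[OF sH] submodule_sum[OF sH] submodule_mult[OF sH])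
      show "g \<in> span_over E H"
        using g(1) span_over_mono[OF E_subring H, of G] by (auto simp: H_def)
      fix b assume "b \<in> B"
      then show "e b \<in> E" "b / x ^ n \<in> span_over E H"
        using eu(1) span_over_base[OF E_subring H, of "b / x ^ n"] by (auto simp: H_def)
    qed
    ultimately show ?thesis by blast
  qed
  then show ?case using H by blast
qed

text \<open>By \<open>N_vanishing\<close> the space \<open>N \<inter> M\<close> embeds into a
  quotient of \<open>M\<close>, finite-dimensional by \<open>M_expansion\<close>. By
  \<open>polar_part\<close> the lattice and \<open>M\<close> together exhaust the span of
  \<open>B\<close>, so \<open>N\<close> is the sum of the lattice and
  \<open>N \<inter> M\<close>.\<close>

lemma lattice_cofinite:
  "\<exists>T. finite T \<and> T \<subseteq> N \<and>
    (\<forall>z\<in>N. \<exists>a\<in>span_over (adjoin E x) B. \<exists>t\<in>span_over E T. z = a + t)"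
proof -
  obtain C where C: "\<And>z. z \<in> N \<Longrightarrow> z * x ^ C \<in> M \<Longrightarrow> z = 0"
    using N_vanishing by blast
  obtain G where G: "finite G" "\<And>m. m \<in> M \<Longrightarrow> \<exists>g\<in>span_over E G. \<exists>m'\<in>M. m = g + m' / x ^ C"
    using M_expansion[of C] by blast
  have ME: "submodule E M" using M_submodule E_subset_V by (rule submodule_mono)
  note NM = submodule_Int[OF N_submodule ME]
  have "\<exists>T. finite T \<and> N \<inter> M = span_over E T"
  proof (rule finitely_generated_extension[OF E_subring NM submodule_quotient[OF ME]
        submodule_span_over[OF E_subring, of G]])
    fix z assume "z \<in> N \<inter> M"
    then obtain g m' where "g \<in> span_over E G" "m' \<in> M" "z = g + m' / x ^ C"
      using G(2) by blast
    then show "\<exists>g\<in>span_over E G. \<exists>m\<in>{u. u * x ^ C \<in> M}. z = g + m"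
      using x_nonzero by (intro bexI[of _ g] bexI[of _ "m' / x ^ C"]) auto
  next
    fix J assume "submodule E J" "J \<subseteq> span_over E G"
    then show "\<exists>T. finite T \<and> J = span_over E T"
      by (rule noetherian_submodule_fg[OF noetherian_subfield[OF subfield] G(1)])
  next
    \<comment> \<open>The kernel of the map into that quotient is zero.\<close>
    have "N \<inter> M \<inter> {u. u * x ^ C \<in> M} = span_over E {}"
      using C submodule_0[OF NM] submodule_0[OF ME] by (auto simp: span_over_def)
    then show "\<exists>T. finite T \<and> N \<inter> M \<inter> {u. u * x ^ C \<in> M} = span_over E T"
      by blast
  qed
  then obtain T where T: "finite T" "N \<inter> M = span_over E T" by blast
  have "\<exists>a\<in>span_over (adjoin E x) B. \<exists>t\<in>span_over E T. z = a + t" if z: "z \<in> N" for z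
  proof -
    obtain n where "z / x ^ n \<in> M"
      using span_bounded_pole z N_span by blast
    then obtain v where v: "\<And>b. b \<in> B \<Longrightarrow> v b \<in> V" "z / x ^ n = (\<Sum>b\<in>B. v b * b)"
      unfolding M_def by (elim span_overE) blast
    have "\<forall>b\<in>B. \<exists>a u. a \<in> adjoin E x \<and> u \<in> V \<and> x ^ n * v b = a + u"
      using polar_part[OF v(1)] by blast
    then obtain a u where au: "\<And>b. b \<in> B \<Longrightarrow> a b \<in> adjoin E x" "\<And>b. b \<in> B \<Longrightarrow> u b \<in> V"
        "\<And>b. b \<in> B \<Longrightarrow> x ^ n * v b = a b + u b"
      by metis
    have "z = x ^ n * (\<Sum>b\<in>B. v b * b)"
      using x_nonzero unfolding v(2)[symmetric] by simp
    also have "\<dots> = (\<Sum>b\<in>B. (a b + u b) * b)"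
      unfolding sum_distrib_left by (intro sum.cong) (simp_all add: mult.assoc flip: au(3))
    finally have zz: "z = (\<Sum>b\<in>B. a b * b) + (\<Sum>b\<in>B. u b * b)"
      by (simp add: distrib_right sum.distrib)
    have 1: "(\<Sum>b\<in>B. a b * b) \<in> span_over (adjoin E x) B"
      using au(1) by (rule span_overI)
    have "(\<Sum>b\<in>B. u b * b) \<in> M"
      unfolding M_def using au(2) by (rule span_overI)
    moreover have "z - (\<Sum>b\<in>B. a b * b) \<in> N"
      using 1 lattice_N z by (intro submodule_diff[OF E_subring N_submodule]) auto
    ultimately have "(\<Sum>b\<in>B. u b * b) \<in> span_over E T"
      using zz unfolding T(2)[symmetric] by simp
    then show ?thesis using zz 1 by blast
  qed
  moreover have "T \<subseteq> N"
    using span_over_base[OF E_subring T(1)] T(2) by blast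
  ultimately show ?thesis using T(1) by blast
qed

end

section \<open>The conductor of the almost integral elements over a polynomial ring\<close>

text \<open>The leading coefficient of \<open>l\<close> lies in the field \<open>E\<close> and so is
  a unit of \<open>R\<close>. Hence the leading coefficient of \<open>p\<close> is in
  \<open>R\<close>, and its leading term can be removed.\<close>

lemma polys_over_cancel_left:
  assumes E: "subfield E" and R: "subring R" "E \<subseteq> R"
    and l: "l \<in> polys_over E" "l \<noteq> 0" and "l * p \<in> polys_over R"
  shows "p \<in> polys_over R"
  using assms(6)
proof (induction "degree p" arbitrary: p rule: less_induct)
  case less
  have "inverse (lead_coeff l) \<in> R"
    using R(2) subfield_inverse[OF E coeff_in_polys_over[OF l(1)]] by blast
  from subring_mult[OF R(1) this coeff_in_polys_over[OF less.prems, of "degree (l * p)"]]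
  have "lead_coeff p \<in> R"
    using l(2) by (simp add: lead_coeff_mult flip: mult.assoc)
  define m where "m = monom (lead_coeff p) (degree p)"
  have m: "m \<in> polys_over R"
    unfolding m_def using R(1) \<open>lead_coeff p \<in> R\<close> by (rule monom_in_polys_over)
  note PR = subring_polys_over[OF R(1)]
  have "l * p - l * m \<in> polys_over R"
    using less.prems
    by (rule subring_diff[OF PR]) (use m l(1) polys_over_mono[OF R(2)] in \<open>auto intro: subring_mult[OF PR]\<close>)
  then have lpm: "l * (p - m) \<in> polys_over R"
    by (simp add: right_diff_distrib)
  have "p - m \<in> polys_over R"
  proof (cases "p - m = 0")
    case True
    then show ?thesis using subring_0[OF PR] by simp
  next
    case False
    have "coeff (p - m) (degree p) = 0" by (simp add: m_def)
    moreover have "degree (p - m) \<le> degree p"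
      unfolding m_def by (intro degree_diff_le) (auto simp: degree_monom_le)
    ultimately have "degree (p - m) < degree p"
      using False by (metis leading_coeff_0_iff le_neq_implies_less)
    then show ?thesis using less.hyps lpm by blast
  qed
  from subring_add[OF PR this m] show ?case by simp
qed

text \<open>An element of \<open>k(X)\<close> that is polynomial in each variable separately is a polynomial; no unique
  factorization is needed, since a denominator \<open>l\<close> free of \<open>y\<close> can be cancelled by comparing leading
  coefficients in \<open>x\<close>.\<close>

lemma polynomial_ring_Inter:
  fixes k :: "'a::field set"
  assumes k: "subfield k" and "finite X" "alg_independent k X"
    and "z \<in> fractions (generated (k \<union> X))"
    and "\<And>x. x \<in> X \<Longrightarrow> z \<in> adjoin (fractions (generated (k \<union> (X - {x})))) x"
  shows "z \<in> generated (k \<union> X)"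
  using assms(2-)
proof (induction X arbitrary: z rule: finite_induct)
  case empty
  have "fractions k \<subseteq> k" using k by (rule fractions_least) simp
  then show ?case
    using empty.prems(2) generated_subring[OF subfield_subring[OF k]] by auto
next
  case (insert x Y)
  define F where "F = fractions (generated (k \<union> Y))"
  have F: "subfield F" unfolding F_def by (intro subfield_fractions subring_generated)
  note Fsub = subfield_subring[OF F]
  have ins: "insert x Y - {x} = Y" using insert.hyps by auto
  have trans: "transcendental_over F x"
    using insert.prems(1) unfolding alg_independent_def F_def by (metis ins insertI1)
  have indep: "alg_independent k Y"
    using insert.prems(1) by (rule alg_independent_mono) auto
  have "z \<in> adjoin F x"
    using insert.prems(3)[of x] unfolding F_def ins by simp
  then obtain p where p: "p \<in> polys_over F" "z = poly p x"
    by (rule adjoinE)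
  \<comment> \<open>This prepares the induction hypothesis for every coefficient of
    \<open>p\<close>: its dependence on each \<open>y\<close> is polynomial.\<close>
  have "p \<in> polys_over (adjoin (fractions (generated (k \<union> (Y - {y})))) y)" if y: "y \<in> Y" for y
  proof -
    define D where "D = generated (k \<union> (Y - {y}))"
    define E where "E = fractions D"
    have D: "subring D" unfolding D_def by (rule subring_generated)
    have E: "subfield E" unfolding E_def using D by (rule subfield_fractions)
    have DE: "D \<subseteq> E" unfolding E_def using D by (rule subset_fractions)
    have EF: "E \<subseteq> F"
      unfolding E_def D_def F_def by (intro fractions_mono generated_mono) auto
    have yF: "y \<in> F"
      unfolding F_def using y generated_mem[of y "k \<union> Y"] subset_fractions[OF subring_generated]
      by blast
    have "k \<union> (insert x Y - {y}) = insert x (k \<union> (Y - {y}))"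
      using insert.hyps y by auto
    then have "z \<in> adjoin (fractions (adjoin D x)) y"
      using insert.prems(3)[of y] y by (simp add: D_def generated_insert)
    then obtain q where q: "q \<in> polys_over (fractions (adjoin D x))" "z = poly q y"
      by (rule adjoinE)
    have "coeff q ` {..degree q} \<subseteq> fractions (adjoin D x)"
      using coeff_in_polys_over[OF q(1)] by auto
    then obtain g where g: "g \<in> adjoin D x" "g \<noteq> 0"
        "\<And>a. a \<in> coeff q ` {..degree q} \<Longrightarrow> g * a \<in> adjoin D x"
      by (elim common_denominator[OF subring_adjoin[OF D], rotated]) auto
    obtain l where l: "l \<in> polys_over D" "g = poly l x"
      using g(1) by (rule adjoinE)
    \<comment> \<open>The order of adjunction is exchanged: with \<open>x\<close> adjoined last,
      \<open>g * z\<close> becomes a polynomial in \<open>x\<close> whose coefficients are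
      polynomials in \<open>y\<close>.\<close>
    define T where "T = adjoin (adjoin D y) x"
    have T: "subring T" unfolding T_def by (intro subring_adjoin D)
    have yT: "y \<in> T"
      unfolding T_def using subset_adjoin[OF subring_adjoin[OF D]] self_in_adjoin[OF D] by blast
    have "g * coeff q i \<in> T" if "i \<le> degree q" for i
      using g(3)[of "coeff q i"] that adjoin_mono[OF subset_adjoin[OF D]] unfolding T_def by blast
    then have "(\<Sum>i\<le>degree q. g * coeff q i * y ^ i) \<in> T"
      using subring_mult[OF T _ subring_power[OF T yT]] by (intro subring_sum[OF T]) blast
    moreover have "(\<Sum>i\<le>degree q. g * coeff q i * y ^ i) = g * z"
      by (simp add: q(2) poly_altdef sum_distrib_left mult.assoc)
    ultimately have "g * z \<in> T" by simp
    then obtain r where r: "r \<in> polys_over (adjoin D y)" "g * z = poly r x"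
      unfolding T_def by (rule adjoinE)
    have rE: "r \<in> polys_over (adjoin E y)"
      using r(1) polys_over_mono[OF adjoin_mono[OF DE]] by blast
    have lE: "l \<in> polys_over E" using l(1) polys_over_mono[OF DE] by blast
    have "l \<in> polys_over F" "r \<in> polys_over F"
      using lE rE polys_over_mono[OF EF] polys_over_mono[OF adjoin_least[OF Fsub EF yF]] by blast+
    \<comment> \<open>Transcendence of \<open>x\<close> over \<open>F\<close> turns the equality of
      values at \<open>x\<close> into an equality of polynomials.\<close>
    then have "l * p - r \<in> polys_over F"
      using subring_polys_over[OF Fsub] p(1) subring_diff subring_mult by blast
    moreover have "poly (l * p - r) x = 0"
      using r(2) p(2) l(2) by simp
    ultimately have "l * p - r = 0"
      by (rule transcendental_overD[OF trans])
    then have lp: "l * p \<in> polys_over (adjoin E y)" using rE by simp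
    have "l \<noteq> 0" using l(2) g(2) by auto
    note Esub = subfield_subring[OF E]
    from polys_over_cancel_left[OF E subring_adjoin[OF Esub] subset_adjoin[OF Esub] lE \<open>l \<noteq> 0\<close> lp]
    show ?thesis unfolding E_def D_def .
  qed
  then have "coeff p i \<in> generated (k \<union> Y)" for i
    using coeff_in_polys_over[OF p(1), of i]
    by (intro insert.IH[OF indep]) (auto simp: F_def intro: coeff_in_polys_over)
  then have "poly p x \<in> adjoin (generated (k \<union> Y)) x"
    by (intro adjoinI) (simp add: polys_over_def)
  then show ?case
    by (simp add: p(2) generated_insert)
qed

lemma span_common_denominator:
  assumes R: "subring R" and fin: "finite T" "finite B" and T: "T \<subseteq> span_over (fractions R) B"
  shows "\<exists>g\<in>R. g \<noteq> 0 \<and> (\<forall>t\<in>T. g * t \<in> span_over R B)"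
proof -
  have "\<forall>t\<in>T. \<exists>c. (\<forall>b\<in>B. c b \<in> fractions R) \<and> t = (\<Sum>b\<in>B. c b * b)"
    using T by (fastforce elim: span_overE)
  then obtain c where c: "\<And>t b. t \<in> T \<Longrightarrow> b \<in> B \<Longrightarrow> c t b \<in> fractions R"
      "\<And>t. t \<in> T \<Longrightarrow> t = (\<Sum>b\<in>B. c t b * b)"
    by metis
  have "finite ((\<lambda>(t, b). c t b) ` (T \<times> B))" "(\<lambda>(t, b). c t b) ` (T \<times> B) \<subseteq> fractions R"
    using fin c(1) by auto
  then obtain g where g: "g \<in> R" "g \<noteq> 0"
      "\<And>q. q \<in> (\<lambda>(t, b). c t b) ` (T \<times> B) \<Longrightarrow> g * q \<in> R"
    using common_denominator[OF R] by blast
  have "g * t \<in> span_over R B" if t: "t \<in> T" for t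
  proof -
    have "(\<Sum>b\<in>B. (g * c t b) * b) \<in> span_over R B"
      using g(3) t by (intro span_overI) auto
    also have "(\<Sum>b\<in>B. (g * c t b) * b) = g * (\<Sum>b\<in>B. c t b * b)"
      by (simp add: sum_distrib_left mult.assoc)
    finally show ?thesis using c(2)[OF t] by simp
  qed
  then show ?thesis using g by blast
qed

lemma conductor_in_one_variable:
  fixes k :: "'a::field set"
  assumes X: "alg_independent k X" "x \<in> X"
    and E_eq: "E = fractions (generated (k \<union> (X - {x})))"
    and P_eq: "P = generated (k \<union> X)"
    and B: "finite B" "lin_independent (fractions P) B" "span_over (fractions P) B = UNIV"
    and U: "subring U" "P \<subseteq> U" "B \<subseteq> U"
    and almost_integral: "\<And>z. z \<in> U \<Longrightarrow> \<exists>g\<in>P. g \<noteq> 0 \<and> (\<forall>j. g * z ^ j \<in> span_over P B)"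
  shows "\<exists>c\<in>P. c \<noteq> 0 \<and> (\<forall>z\<in>U. c * z \<in> span_over (adjoin E x) B)"
proof -
  define D where "D = generated (k \<union> (X - {x}))"
  have D: "subring D" unfolding D_def by (rule subring_generated)
  have DE: "D \<subseteq> E" unfolding E_eq D_def by (intro subset_fractions subring_generated)
  have E: "subfield E" unfolding E_eq by (intro subfield_fractions subring_generated)
  note Esub = subfield_subring[OF E]
  have "insert x (k \<union> (X - {x})) = k \<union> X" using X(2) by auto
  then have PD: "P = adjoin D x"
    by (simp add: P_eq D_def flip: generated_insert)
  have P: "subring P" unfolding PD using D by (rule subring_adjoin)
  have DP: "D \<subseteq> P" unfolding PD using D by (rule subset_adjoin)
  have xP: "x \<in> P" unfolding PD using D by (rule self_in_adjoin)
  have PE: "P \<subseteq> adjoin E x" unfolding PD using DE by (rule adjoin_mono)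
  have F: "subfield (fractions P)" using P by (rule subfield_fractions)
  have EF: "E \<subseteq> fractions P" unfolding E_eq D_def[symmetric] using DP by (rule fractions_mono)
  have "adjoin E x \<subseteq> fractions P"
    using EF xP subset_fractions[OF P] by (intro adjoin_least subfield_subring[OF F]) auto
  then have F_eq: "fractions (adjoin E x) = fractions P"
    using fractions_least[OF F] fractions_mono[OF PE] by blast
  \<comment> \<open>The localization of \<open>U\<close> at the nonzero elements of
    \<open>D\<close>. It is a module over \<open>E\<close>, which \<open>U\<close> need not
    be.\<close>
  define N where "N = {z. \<exists>s\<in>D. s \<noteq> 0 \<and> s * z \<in> U}"
  have UN: "U \<subseteq> N" unfolding N_def using subring_1[OF D] by (auto intro!: bexI[of _ 1])
  have DU: "D \<subseteq> U" using DP U(2) by blast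
  have N: "subring N"
    unfolding subring_def
  proof (intro conjI ballI)
    show "1 \<in> N" using UN subring_1[OF U(1)] by blast
    fix z w assume "z \<in> N" "w \<in> N"
    then obtain s t where st: "s \<in> D" "s \<noteq> 0" "s * z \<in> U" "t \<in> D" "t \<noteq> 0" "t * w \<in> U"
      unfolding N_def by blast
    have "t * (s * z) - s * (t * w) \<in> U" "(s * z) * (t * w) \<in> U"
      using st DU by (auto intro!: subring_diff[OF U(1)] subring_mult[OF U(1)])
    moreover have "t * (s * z) - s * (t * w) = s * t * (z - w)" "(s * z) * (t * w) = s * t * (z * w)"
      by (simp_all add: algebra_simps)
    moreover have "s * t \<in> D" "s * t \<noteq> 0"
      using st subring_mult[OF D] by auto
    ultimately show "z - w \<in> N" "z * w \<in> N"
      unfolding N_def by (metis (mono_tags, lifting) mem_Collect_eq)+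
  qed
  have EN: "E \<subseteq> N"
  proof
    fix e assume "e \<in> E"
    then obtain a b where "a \<in> D" "b \<in> D" "b \<noteq> 0" "e = a / b"
      unfolding E_eq D_def[symmetric] by (elim fractionsE[OF D])
    then show "e \<in> N" unfolding N_def using DU by (auto intro!: bexI[of _ b])
  qed
  have adjN: "adjoin E x \<subseteq> N"
    using xP U(2) UN by (intro adjoin_least[OF N EN]) auto
  have LN: "span_over (adjoin E x) B \<subseteq> N"
    using U(3) UN by (intro span_over_least submodule_subring[OF N adjN]) auto
  interpret almost_integral_module E x B N
  proof
    show "subfield E" by (rule E)
    show "transcendental_over E x"
      using X unfolding alg_independent_def E_eq by blast
    show "finite B" by (rule B(1))
    show "lin_independent (fractions (adjoin E x)) B" unfolding F_eq by (rule B(2))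
    show "\<And>b c. b \<in> B \<Longrightarrow> c \<in> B \<Longrightarrow> b * c \<in> span_over (fractions (adjoin E x)) B"
      and "N \<subseteq> span_over (fractions (adjoin E x)) B"
      unfolding F_eq B(3) by auto
    show "submodule E N" using N EN by (rule submodule_subring)
    show "span_over (adjoin E x) B \<subseteq> N" by (rule LN)
    fix z assume "z \<in> N"
    then obtain s where s: "s \<in> D" "s \<noteq> 0" "s * z \<in> U" unfolding N_def by blast
    obtain g where g: "g \<in> P" "g \<noteq> 0" "\<And>j. g * (s * z) ^ j \<in> span_over P B"
      using almost_integral[OF s(3)] by blast
    note sL = submodule_span_over[OF subring_adjoin[OF Esub]]
    \<comment> \<open>\<open>s\<close> is a unit of \<open>E\<close>, so its powers cost nothing and
      one \<open>g\<close> serves for all exponents \<open>j\<close>.\<close>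
    have "g * z ^ j \<in> span_over (adjoin E x) B" for j
    proof -
      have "inverse s ^ j \<in> adjoin E x"
        using s(1) DE subset_adjoin[OF Esub] subfield_inverse[OF E] subring_power[OF Esub] by blast
      then have "inverse s ^ j * (g * (s * z) ^ j) \<in> span_over (adjoin E x) B"
        using subsetD[OF span_over_mono_ring[OF PE] g(3)] by (rule submodule_mult[OF sL])
      moreover have "inverse s ^ j * (g * (s * z) ^ j) = g * z ^ j"
        using s(2) by (simp add: power_mult_distrib field_simps)
      ultimately show ?thesis by simp
    qed
    then show "\<exists>g\<in>adjoin E x. g \<noteq> 0 \<and> (\<forall>j. g * z ^ j \<in> span_over (adjoin E x) B)"
      using g PE by blast
  qed
  obtain T where T: "finite T"
      "\<And>z. z \<in> N \<Longrightarrow> \<exists>a\<in>span_over (adjoin E x) B. \<exists>t\<in>span_over E T. z = a + t"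
    using lattice_cofinite by blast
  obtain c where c: "c \<in> P" "c \<noteq> 0" "\<And>t. t \<in> T \<Longrightarrow> c * t \<in> span_over P B"
    using span_common_denominator[OF P T(1) B(1)] B(3) by auto
  note sL = submodule_span_over[OF subring_adjoin[OF Esub], of x B]
  have "c * z \<in> span_over (adjoin E x) B" if z: "z \<in> U" for z
  proof -
    obtain a t where at: "a \<in> span_over (adjoin E x) B" "t \<in> span_over E T" "z = a + t"
      using T(2) z UN by blast
    have "span_over E T \<subseteq> {u. u * c \<in> span_over (adjoin E x) B}"
      using c(3) span_over_mono_ring[OF PE, of B]
      by (intro span_over_least submodule_quotient submodule_mono[OF sL subset_adjoin[OF Esub]])
         (auto simp: mult.commute)
    then have "c * t \<in> span_over (adjoin E x) B"
      using at(2) by (auto simp: mult.commute)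
    moreover have "c * a \<in> span_over (adjoin E x) B"
      using c(1) PE at(1) by (intro submodule_mult[OF sL]) auto
    ultimately show ?thesis
      unfolding at(3) distrib_left by (intro submodule_add[OF sL])
  qed
  then show ?thesis using c by blast
qed

lemma conductor_exists:
  fixes k :: "'a::field set"
  assumes k: "subfield k" and X: "finite X" "alg_independent k X"
    and P_eq: "P = generated (k \<union> X)"
    and B: "finite B" "lin_independent (fractions P) B" "span_over (fractions P) B = UNIV"
    and U: "subring U" "P \<subseteq> U" "B \<subseteq> U"
    and almost_integral: "\<And>z. z \<in> U \<Longrightarrow> \<exists>g\<in>P. g \<noteq> 0 \<and> (\<forall>j. g * z ^ j \<in> span_over P B)"
  shows "\<exists>c\<in>P. c \<noteq> 0 \<and> (\<forall>z\<in>U. c * z \<in> span_over P B)"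
proof -
  define E where "E x = fractions (generated (k \<union> (X - {x})))" for x
  have P: "subring P" unfolding P_eq by (rule subring_generated)
  note F = subfield_subring[OF subfield_fractions[OF P]]
  have E: "subring (E x)" for x
    unfolding E_def by (intro subfield_subring subfield_fractions subring_generated)
  have PE: "P \<subseteq> adjoin (E x) x" if "x \<in> X" for x
  proof -
    have "insert x (k \<union> (X - {x})) = k \<union> X" using that by auto
    then have "P = adjoin (generated (k \<union> (X - {x}))) x"
      by (simp add: P_eq flip: generated_insert)
    then show ?thesis
      unfolding E_def by (simp add: adjoin_mono subset_fractions subring_generated)
  qed
  have EF: "adjoin (E x) x \<subseteq> fractions P" if "x \<in> X" for x
  proof (rule adjoin_least[OF F])
    show "E x \<subseteq> fractions P"
      unfolding E_def P_eq by (intro fractions_mono generated_mono) auto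
    show "x \<in> fractions P"
      using that subset_fractions[OF P] unfolding P_eq by (auto intro: generated_mem)
  qed
  have "\<forall>x\<in>X. \<exists>c. c \<in> P \<and> c \<noteq> 0 \<and> (\<forall>z\<in>U. c * z \<in> span_over (adjoin (E x) x) B)"
    using conductor_in_one_variable[OF X(2) _ E_def P_eq B U almost_integral] by blast
  then obtain c where c: "\<And>x. x \<in> X \<Longrightarrow> c x \<in> P" "\<And>x. x \<in> X \<Longrightarrow> c x \<noteq> 0"
      "\<And>x z. x \<in> X \<Longrightarrow> z \<in> U \<Longrightarrow> c x * z \<in> span_over (adjoin (E x) x) B"
    by metis
  \<comment> \<open>For empty \<open>X\<close> the product is \<open>1\<close>, and the intersection
    argument reduces to \<open>P\<close> being the field \<open>k\<close>.\<close>
  define d where "d = prod c X"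
  have d: "d \<in> P" "d \<noteq> 0"
    unfolding d_def using c(1,2) X(1) by (auto intro: subring_prod[OF P])
  have "d * z \<in> span_over P B" if z: "z \<in> U" for z
  proof -
    have dz: "d * z \<in> span_over (adjoin (E x) x) B" if x: "x \<in> X" for x
    proof -
      have "prod c (X - {x}) \<in> adjoin (E x) x"
        using c(1) PE[OF x] subring_prod[OF P, of "X - {x}" c] by blast
      then have "prod c (X - {x}) * (c x * z) \<in> span_over (adjoin (E x) x) B"
        using c(3)[OF x z] by (rule submodule_mult[OF submodule_span_over[OF subring_adjoin[OF E]]])
      also have "prod c (X - {x}) * (c x * z) = d * z"
        unfolding d_def using prod.remove[OF X(1) x, of c] by (simp add: mult_ac)
      finally show ?thesis .
    qed
    obtain f where f: "\<And>b. b \<in> B \<Longrightarrow> f b \<in> fractions P" "d * z = (\<Sum>b\<in>B. f b * b)"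
      using B(3) by (elim span_overE[of "d * z" "fractions P" B, rotated]) auto
    have "f b \<in> P" if b: "b \<in> B" for b
      unfolding P_eq
    proof (rule polynomial_ring_Inter[OF k X])
      show "f b \<in> fractions (generated (k \<union> X))" using f(1)[OF b] unfolding P_eq .
      fix x assume x: "x \<in> X"
      obtain h where h: "\<And>b. b \<in> B \<Longrightarrow> h b \<in> adjoin (E x) x" "d * z = (\<Sum>b\<in>B. h b * b)"
        using dz[OF x] by (elim span_overE) blast
      \<comment> \<open>Coordinates with respect to \<open>B\<close> are unique over the fractions
        of \<open>P\<close>, so one and the same \<open>f b\<close> lies in all the rings
        \<open>adjoin (E x) x\<close>.\<close>
      have "f b = h b"
      proof (rule lin_independent_coeff_eq[OF B(2) F _ _ _ b])
        show "(\<Sum>b\<in>B. f b * b) = (\<Sum>b\<in>B. h b * b)"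
          by (simp only: flip: f(2) h(2))
      qed (use f(1) h(1) EF[OF x] in blast)+
      then show "f b \<in> adjoin (fractions (generated (k \<union> (X - {x})))) x"
        using h(1)[OF b] unfolding E_def by simp
    qed
    then show ?thesis
      unfolding f(2) by (rule span_overI)
  qed
  then show ?thesis using d by blast
qed

section \<open>Finiteness of the integral closure\<close>

text \<open>Once powers of \<open>b\<close> are cancelled, the constant term of an equation for
  \<open>b\<close> is a nonzero multiple of \<open>b\<close>. It serves to replace denominators from
  \<open>A\<close> by denominators from \<open>P\<close>.\<close>

lemma nonzero_integral_divides:
  fixes b :: "'a::field"
  assumes P: "subring P" "P \<subseteq> A" and A: "subring A" "b \<in> A"
    and b: "b \<noteq> 0" "integral_over P b"
  shows "\<exists>c\<in>P. c \<noteq> 0 \<and> (\<exists>q\<in>A. c = b * q)"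
proof -
  obtain p where p: "p \<in> polys_over P" "lead_coeff p = 1" "poly p b = 0"
    using b(2) by (auto simp: integral_over_def)
  then have "p \<noteq> 0" by auto
  with p(1,3) show ?thesis
  proof (induction p)
    case (pCons a p)
    then have ap: "a \<in> P" "p \<in> polys_over P" by (auto simp: pCons_in_polys_over)
    show ?case
    proof (cases "a = 0")
      case True
      then have "poly p b = 0" "p \<noteq> 0" using pCons.prems b(1) by auto
      then show ?thesis using pCons.IH ap by blast
    next
      case False
      have "poly p b \<in> A"
        using ap(2) polys_over_mono[OF P(2)] A by (intro poly_in_subring) auto
      then have "- poly p b \<in> A" by (rule subring_uminus[OF A(1)])
      moreover have "a = b * (- poly p b)"
        using pCons.prems(2) by (simp add: add_eq_0_iff2)
      ultimately show ?thesis using False ap(1) by blast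
    qed
  qed simp
qed

theorem integral_closure_finitely_generated:
  fixes k :: "'a::field set"
  assumes k: "subfield k" and S: "finite S" and A_eq: "A = generated (k \<union> S)"
    and frac: "fractions A = UNIV"
  shows "\<exists>T. finite T \<and> {z. finite_over A z} = span_over A T"
proof -
  obtain X where X: "finite X" "alg_independent k X" "X \<subseteq> A"
      "\<And>s. s \<in> S \<Longrightarrow> finite_over (generated (k \<union> X)) s"
    using noether_normalization[OF k S] unfolding A_eq by blast
  define P where "P = generated (k \<union> X)"
  have P: "subring P" "noetherian_subring P"
    unfolding P_def using X(1) noetherian_generated[OF noetherian_subfield[OF k]]
    by (auto intro: subring_generated)
  have A: "subring A" unfolding A_eq by (rule subring_generated)
  have PA: "P \<subseteq> A"
    unfolding P_def using X(3) by (intro generated_least A) (auto simp: A_eq intro: generated_mem)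
  obtain G0 where G0: "finite G0" "generated (P \<union> S) \<subseteq> span_over P G0"
    using generated_finite_over[OF P(1) S] X(4) unfolding P_def by blast
  have "A \<subseteq> generated (P \<union> S)"
    unfolding A_eq P_def by (intro generated_least subring_generated) (auto intro: generated_mem)
  \<comment> \<open>\<open>A\<close> is contained in a finite module over the Noetherian ring
    \<open>P\<close>, hence is itself one.\<close>
  then obtain G where G: "finite G" "A = span_over P G"
    using noetherian_submodule_fg[OF P(2) G0(1) submodule_subring[OF A PA]] G0(2) by blast
  have GA: "G \<subseteq> A" using span_over_base[OF P(1) G(1)] G(2) by blast
  define F where "F = fractions P"
  have F: "subfield F" unfolding F_def using P(1) by (rule subfield_fractions)
  have PF: "P \<subseteq> F" unfolding F_def using P(1) by (rule subset_fractions)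
  \<comment> \<open>Numerators stay in \<open>A\<close>, which \<open>G\<close> spans over
    \<open>P\<close>, while the denominator is moved into \<open>P\<close>.\<close>
  have "z \<in> span_over F G" for z
  proof -
    have "z \<in> fractions A" using frac by simp
    then obtain a b where ab: "a \<in> A" "b \<in> A" "b \<noteq> 0" "z = a / b"
      by (rule fractionsE[OF A])
    have "integral_over P b"
      using finite_over_in_span[OF A _ G(1) ab(2)] G(2) by (intro finite_over_imp_integral P(2)) auto
    then obtain c q where cq: "c \<in> P" "c \<noteq> 0" "q \<in> A" "c = b * q"
      using nonzero_integral_divides[OF P(1) PA A ab(2,3)] by blast
    have "a * q \<in> span_over F G"
      using subring_mult[OF A ab(1) cq(3)] G(2) span_over_mono_ring[OF PF] by auto
    moreover have "inverse c \<in> F"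
      using cq(1) PF subfield_inverse[OF F] by blast
    ultimately have "inverse c * (a * q) \<in> span_over F G"
      using submodule_mult[OF submodule_span_over[OF subfield_subring[OF F]]] by blast
    moreover have "inverse c * (a * q) = z"
      using cq ab by (simp add: field_simps)
    ultimately show ?thesis by simp
  qed
  then obtain B where B: "B \<subseteq> G" "lin_independent F B" "span_over F B = UNIV"
    using spanning_set_contains_basis[OF F G(1)] by auto
  have finB: "finite B" using B(1) G(1) by (rule finite_subset)
  define U where "U = {z. finite_over A z}"
  have U: "subring U" unfolding U_def using A by (rule subring_finite_over)
  have AU: "A \<subseteq> U" unfolding U_def using finite_over_self[OF A] by blast
  have "\<exists>g\<in>P. g \<noteq> 0 \<and> (\<forall>j. g * z ^ j \<in> span_over P B)" if "z \<in> U" for z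
  proof -
    have "finite_over P z"
      using that G unfolding U_def by (intro finite_over_trans[OF P(1) _ G(1), of A]) auto
    then obtain T where T: "finite T" "\<And>j. z ^ j \<in> span_over P T"
      unfolding finite_over_def by blast
    obtain g where g: "g \<in> P" "g \<noteq> 0" "\<And>t. t \<in> T \<Longrightarrow> g * t \<in> span_over P B"
      using span_common_denominator[OF P(1) T(1) finB] B(3) unfolding F_def by auto
    have "span_over P T \<subseteq> {u. u * g \<in> span_over P B}"
      using g(3) by (intro span_over_least submodule_quotient submodule_span_over[OF P(1)])
        (auto simp: mult.commute)
    then have "g * z ^ j \<in> span_over P B" for j
      using T(2)[of j] by (auto simp: mult.commute)
    then show ?thesis using g by blast
  qed
  then obtain c where c: "c \<in> P" "c \<noteq> 0" "\<And>z. z \<in> U \<Longrightarrow> c * z \<in> span_over P B"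
    using conductor_exists[OF k X(1,2) P_def finB B(2,3)[unfolded F_def] U] PA AU B(1) GA by blast
  have "z \<in> span_over P ((\<lambda>b. b / c) ` B)" if z: "z \<in> U" for z
  proof -
    obtain f where f: "\<And>b. b \<in> B \<Longrightarrow> f b \<in> P" "c * z = (\<Sum>b\<in>B. f b * b)"
      using c(3)[OF z] by (elim span_overE) blast
    have "z = (c * z) / c" using c(2) by simp
    also have "\<dots> = (\<Sum>b\<in>B. f b * (b / c))"
      by (simp add: f(2) sum_divide_distrib)
    also have "\<dots> \<in> span_over P ((\<lambda>b. b / c) ` B)"
      using f(1) finB submodule_span_over[OF P(1)]
      by (intro submodule_sum[of P] submodule_mult[of P] span_over_base[OF P(1)]) auto
    finally show ?thesis .
  qed
  moreover have "submodule P U"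
    using PA AU by (intro submodule_subring[OF U]) auto
  ultimately obtain T where T: "finite T" "U = span_over P T"
    using noetherian_submodule_fg[OF P(2), of "(\<lambda>b. b / c) ` B" U] finB by blast
  \<comment> \<open>Generators over \<open>P\<close> also generate over the larger ring
    \<open>A\<close>.\<close>
  have "span_over A T \<subseteq> U"
    using span_over_base[OF P(1) T(1)] T(2)
    by (intro span_over_least submodule_subring[OF U AU]) auto
  moreover have "U \<subseteq> span_over A T"
    unfolding T(2) using PA by (rule span_over_mono_ring)
  ultimately have "U = span_over A T" by blast
  then show ?thesis using T(1) unfolding U_def by blast
qed

section \<open>Affine domains and their fields of fractions\<close>

lemma module_times: "module ((*) :: 'r::comm_ring_1 \<Rightarrow> 'r \<Rightarrow> 'r)"
  by unfold_locales (simp_all add: algebra_simps)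

lemma span_fract_smult:
  assumes "finite T"
  shows "module.span fract_smult T = span_over (range to_fract) T"
proof -
  interpret module "fract_smult :: 'a \<Rightarrow> 'a fract \<Rightarrow> 'a fract"
    by (rule module_fract_smult)
  show ?thesis
  proof
    show "span T \<subseteq> span_over (range to_fract) T"
      unfolding span_finite[OF assms] fract_smult_def by (auto intro!: span_overI)
    show "span_over (range to_fract) T \<subseteq> span T"
    proof
      fix y assume "y \<in> span_over (range to_fract) T"
      then obtain c where c: "\<And>t. t \<in> T \<Longrightarrow> c t \<in> range to_fract" "y = (\<Sum>t\<in>T. c t * t)"
        by (elim span_overE) blast
      have "c t * t \<in> span T" if "t \<in> T" for t
        using c(1)[OF that] span_scale[OF span_base[OF that]] by (auto simp: fract_smult_def)
      then show "y \<in> span T"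
        unfolding c(2) by (rule span_sum)
    qed
  qed
qed

lemma subring_range_to_fract: "subring (range to_fract)"
  unfolding subring_def
  by (auto simp flip: to_fract_1 to_fract_diff to_fract_mult)

lemma fractions_range_to_fract: "fractions (range to_fract) = UNIV"
proof -
  have "z \<in> fractions (range to_fract)" for z :: "'a fract"
  proof (cases z)
    case (Fract a b)
    then have "z = to_fract a / to_fract b"
      by (simp add: to_fract_def)
    then show ?thesis by (simp add: fractionsI)
  qed
  then show ?thesis by blast
qed

text \<open>Ideals of \<open>'a\<close> are carried along the injection \<open>to_fract\<close>,
  since the Noetherian argument takes place inside the fraction field.\<close>

lemma noetherian_of_range_to_fract:
  assumes "noetherian_subring (range (to_fract :: 'a::idom \<Rightarrow> 'a fract))"
  shows "noetherian TYPE('a)"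
  unfolding noetherian_def fg_submodule_def
proof (intro allI impI)
  interpret module "(*) :: 'a \<Rightarrow> 'a \<Rightarrow> 'a" by (rule module_times)
  fix I :: "'a set" assume I: "subspace I"
  let ?A = "range (to_fract :: 'a \<Rightarrow> 'a fract)"
  have "submodule ?A (to_fract ` I)"
    unfolding submodule_def
  proof (intro conjI ballI)
    show "0 \<in> to_fract ` I"
      using subspace_0[OF I] by (metis image_eqI to_fract_0)
    fix x y assume "x \<in> to_fract ` I" "y \<in> to_fract ` I"
    then show "x + y \<in> to_fract ` I"
      using subspace_add[OF I] by (auto simp flip: to_fract_add)
  next
    fix r x assume "r \<in> ?A" "x \<in> to_fract ` I"
    then show "r * x \<in> to_fract ` I"
      using subspace_scale[OF I] by (auto simp flip: to_fract_mult)
  qed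
  then obtain T where T: "finite T" "to_fract ` I = span_over ?A T"
    using assms unfolding noetherian_subring_def by (meson image_mono subset_UNIV)
  have "T \<subseteq> to_fract ` I"
    using span_over_base[OF subring_range_to_fract T(1)] T(2) by blast
  then obtain S where S: "finite S" "S \<subseteq> I" "T = to_fract ` S"
    using T(1) by (metis finite_subset_image)
  have "I \<subseteq> span S"
  proof
    fix a assume "a \<in> I"
    then have "to_fract a \<in> span_over ?A T" using T(2) by blast
    then obtain c where c: "\<And>t. t \<in> T \<Longrightarrow> c t \<in> ?A" "to_fract a = (\<Sum>t\<in>T. c t * t)"
      by (elim span_overE) blast
    have "\<forall>s\<in>S. \<exists>d. c (to_fract s) = to_fract d"
      using c(1) S(3) by blast
    then obtain d where d: "\<And>s. s \<in> S \<Longrightarrow> c (to_fract s) = to_fract (d s)"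
      by metis
    have "to_fract a = (\<Sum>s\<in>S. c (to_fract s) * to_fract s)"
      unfolding c(2) S(3) by (subst sum.reindex) (auto intro: inj_onI)
    also have "\<dots> = to_fract (\<Sum>s\<in>S. d s * s)"
      by (simp add: d to_fract_sum)
    finally have "a = (\<Sum>s\<in>S. d s * s)" by (simp only: to_fract_eq_iff)
    also have "\<dots> \<in> span S"
      by (intro span_sum span_scale span_base)
    finally show "a \<in> span S" .
  qed
  moreover have "span S \<subseteq> I" using S(2) I by (rule span_minimal)
  ultimately show "\<exists>S. finite S \<and> span S = I" using S(1) by blast
qed

lemma integral_closure_eq: "integral_closure = {z. integral_over (range to_fract) z}"
proof -
  have "z \<in> integral_closure \<longleftrightarrow> integral_over (range to_fract) z" for z :: "'a fract"
  proof
    assume "z \<in> integral_closure"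
    then obtain p :: "'a poly" where p: "lead_coeff p = 1" "poly (map_poly to_fract p) z = 0"
      unfolding integral_closure_def by blast
    have "lead_coeff (map_poly to_fract p) = 1"
      using p(1) by (simp add: coeff_map_poly degree_map_poly)
    then show "integral_over (range to_fract) z"
      unfolding integral_over_def polys_over_def using p(2)
      by (intro bexI[of _ "map_poly to_fract p"]) (auto simp: coeff_map_poly)
  next
    assume "integral_over (range to_fract) z"
    then obtain p where p: "\<And>i. coeff p i \<in> range to_fract" "lead_coeff p = 1" "poly p z = 0"
      unfolding integral_over_def polys_over_def by blast
    define q where "q = map_poly (inv to_fract) p"
    have inj: "inj (to_fract :: 'a \<Rightarrow> 'a fract)" by (auto intro: injI)
    \<comment> \<open>\<open>map_poly\<close> acts coefficientwise only for maps fixing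
      \<open>0\<close>, so this is checked for the inverse.\<close>
    have inv0: "inv to_fract (0 :: 'a fract) = 0"
      using inv_f_f[OF inj, of 0] by simp
    have q: "map_poly to_fract q = p"
      using p(1) by (intro poly_eqI) (simp add: q_def coeff_map_poly inv0 f_inv_into_f)
    have "to_fract (lead_coeff q) = lead_coeff (map_poly to_fract q)"
      by (simp add: coeff_map_poly degree_map_poly)
    then have "lead_coeff q = 1"
      unfolding q p(2) by (metis to_fract_1 to_fract_eq_iff)
    then show "z \<in> integral_closure"
      unfolding integral_closure_def using p(3) q by blast
  qed
  then show ?thesis by blast
qed

text \<open>Scalars act on \<open>A\<close> as multiplication by the elements
  \<open>scale c 1\<close>, whose images form a subfield. This turns generation as an algebra into
  generation as a ring inside the fraction field.\<close>

lemma affine_algebra_generated: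
  fixes scale :: "'k::field \<Rightarrow> 'a::idom \<Rightarrow> 'a"
  assumes "affine_algebra scale"
  shows "\<exists>k S. subfield k \<and> finite S \<and> range (to_fract :: 'a \<Rightarrow> 'a fract) = generated (k \<union> S)"
proof -
  interpret affine_algebra scale by fact
  define \<iota> where "\<iota> c = to_fract (scale c 1)" for c
  have mult: "\<iota> c * \<iota> d = \<iota> (c * d)" for c d
    by (simp add: \<iota>_def scale_mult_left flip: to_fract_mult)
  have one: "\<iota> 1 = 1" by (simp add: \<iota>_def)
  have k: "subfield (range \<iota>)"
    unfolding subfield_def subring_def
  proof (intro conjI ballI)
    show "1 \<in> range \<iota>" using one by (metis rangeI)
  next
    fix x y assume "x \<in> range \<iota>" "y \<in> range \<iota>"
    then obtain c d where cd: "x = \<iota> c" "y = \<iota> d" by blast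
    have "x - y = \<iota> (c - d)"
      by (simp add: cd \<iota>_def scale_left_diff_distrib)
    then show "x - y \<in> range \<iota>" by simp
    show "x * y \<in> range \<iota>" by (simp add: cd mult)
  next
    fix x assume "x \<in> range \<iota>"
    then obtain c where c: "x = \<iota> c" by blast
    have "inverse x = \<iota> (inverse c)"
    proof (cases "c = 0")
      case True
      then show ?thesis by (simp add: c \<iota>_def)
    next
      case False
      then have "x * \<iota> (inverse c) = 1" by (simp add: c mult one)
      then show ?thesis by (rule inverse_unique)
    qed
    then show "inverse x \<in> range \<iota>" by simp
  qed
  obtain S where S: "finite S" "is_subalgebra scale hull S = UNIV"
    using finitely_generated unfolding finitely_generated_algebra_def by blast
  let ?A = "generated (range \<iota> \<union> to_fract ` S)"
  note A = subring_generated[of "range \<iota> \<union> to_fract ` S"]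
  have \<iota>A: "\<iota> c \<in> ?A" for c by (rule generated_mem) simp
  \<comment> \<open>The elements with image in \<open>?A\<close> form a subalgebra containing
    \<open>S\<close>, so by minimality of the hull they are all of \<open>'a\<close>.\<close>
  have "is_subalgebra scale {a. to_fract a \<in> ?A}"
    unfolding is_subalgebra_def subspace_def
  proof (intro conjI ballI allI CollectI)
    fix c x assume "x \<in> {a. to_fract a \<in> ?A}"
    moreover have "to_fract (scale c x) = \<iota> c * to_fract x"
      by (simp add: \<iota>_def scale_mult_left flip: to_fract_mult)
    ultimately show "to_fract (scale c x) \<in> ?A"
      using subring_mult[OF A \<iota>A] by simp
  qed (use subring_0[OF A] subring_1[OF A] subring_add[OF A] subring_mult[OF A] in simp_all)
  moreover have "S \<subseteq> {a. to_fract a \<in> ?A}"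
    by (auto intro: generated_mem)
  ultimately have "is_subalgebra scale hull S \<subseteq> {a. to_fract a \<in> ?A}"
    by (intro hull_minimal)
  then have "range to_fract \<subseteq> ?A"
    unfolding S(2) by blast
  moreover have "?A \<subseteq> range to_fract"
    by (intro generated_least subring_range_to_fract) (auto simp: \<iota>_def)
  ultimately show ?thesis
    using k S(1) by (intro exI[of _ "range \<iota>"] exI[of _ "to_fract ` S"]) auto
qed

theorem theorem5p3:
  fixes scale :: "'k::field \<Rightarrow> 'a::idom \<Rightarrow> 'a"
  assumes "affine_algebra scale"
    and "\<not> integrally_closed TYPE('a)"
  shows "galois_order scale (integral_closure :: 'a fract set)
    \<and> \<not> principal_galois_order scale (integral_closure :: 'a fract set)"
proof -
  interpret affine_algebra scale by fact
  interpret K: module "(*) :: 'a fract \<Rightarrow> 'a fract \<Rightarrow> 'a fract" by (rule module_times)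
  interpret scaled: comm_k_algebra "fract_scale scale"
    by (rule comm_k_algebra_fract_scale) unfold_locales
  let ?A = "range (to_fract :: 'a \<Rightarrow> 'a fract)"
  let ?U = "integral_closure :: 'a fract set"
  obtain k S where kS: "subfield k" "finite S" "?A = generated (k \<union> S)"
    using affine_algebra_generated[OF assms(1)] by blast
  have noeth: "noetherian_subring ?A"
    unfolding kS(3) using kS(1,2) by (intro noetherian_generated noetherian_subfield)
  have U_eq: "?U = {z. finite_over ?A z}"
    unfolding integral_closure_eq
    using finite_over_imp_integral[OF noeth] integral_imp_finite_over[OF subring_range_to_fract]
    by blast
  have U: "subring ?U"
    unfolding U_eq using subring_range_to_fract by (rule subring_finite_over)
  have AU: "?A \<subseteq> ?U"
    using to_fract_in_integral_closure by blast
  \<comment> \<open>Scalars of the base field act through elements of \<open>A\<close>, so closure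
    under them is a case of closure under multiplication.\<close>
  have "is_subalgebra (fract_scale scale) ?U"
    unfolding is_subalgebra_def scaled.subspace_def
    using subring_0[OF U] subring_1[OF U] subring_add[OF U] subring_mult[OF U]
      subsetD[OF AU rangeI]
    by (auto simp: fract_scale_def)
  moreover have "K.span ?U = UNIV"
    using K.span_scale[OF K.span_base[OF subring_1[OF U]]] by auto
  ultimately have ring: "galois_ring scale ?U"
    unfolding galois_ring_def using noetherian_of_range_to_fract[OF noeth] AU by blast
  obtain T where T: "finite T" "?U = span_over ?A T"
    using integral_closure_finitely_generated[OF kS fractions_range_to_fract] unfolding U_eq by blast
  have "fg_submodule fract_smult (?U \<inter> V)" if V: "K.subspace V" for V
  proof (cases "V \<subseteq> {0}")
    case True
    then have "?U \<inter> V = {0}"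
      using K.subspace_0[OF V] subring_0[OF U] by auto
    moreover have "module.span fract_smult {} = ({0} :: 'a fract set)"
      by (rule module.span_empty[OF module_fract_smult])
    ultimately show ?thesis unfolding fg_submodule_def by (metis finite.emptyI)
  next
    case False
    then obtain v where "v \<in> V" "v \<noteq> 0" by auto
    then have "z \<in> V" for z
      using K.subspace_scale[OF V, of v "z / v"] by simp
    then have "?U \<inter> V = ?U" by auto
    then show ?thesis
      unfolding fg_submodule_def using T span_fract_smult by metis
  qed
  then have "galois_order scale ?U"
    using ring unfolding galois_order_def by blast
  moreover have "\<not> principal_galois_order scale ?U"
  proof
    assume "principal_galois_order scale ?U"
    then have "X \<in> ?A" if "X \<in> ?U" for X
      using that unfolding principal_galois_order_def fract_act_def
      by (metis image_subset_iff mult.right_neutral rangeI to_fract_1)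
    then have "?U = ?A" using AU by blast
    then show False using assms(2) by (simp add: integrally_closed_def)
  qed
  ultimately show ?thesis by blast
qed

end
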